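(* Let $a,b,n$ be positive integers. Then the $Z$-polynomial of the $(a,b)$-Catalan matroid satisfies $$Z_{C_n^{a,b}}(t)=\sum_{\lambda\vdash n}\frac1{z_\lambda}\,Z_{U_\lambda^{a,b}}(t),$$ where the sum is over all partitions $\lambda=(\lambda_1,\dots,\lambda_k)$ of $n$ and $Z_{U_\lambda^{a,b}}(t)=\prod_{j=1}^k Z_{U_{\lambda_j}^{a,b}}(t)$.
   Context: For $m\ge1$, $U_m^{a,b}=U_{mb,m(a+b)}$ is the uniform matroid of rank $mb$ on $m(a+b)$ elements. For $S\subseteq[N]$, the Schubert matroid $\mathrm{SM}_N(S)$ is the matroid on $[N]$ whose bases are the $T\subseteq[N]$ with $|T|=|S|$ such that for every $i$ the $i$-th smallest element of $T$ is at most the $i$-th smallest element of $S$. The $(a,b)$-Catalan matroid $C_n^{a,b}$ is $\mathrm{SM}_{n(a+b)}(S)$ where $S$ has indicator vector $(0^a,1^b,\dots,0^a,1^b)$ ($n$ blocks of $a$ zeros followed by $b$ ones). For a partition $\lambda$ of $n$ in which $i$ appears $\alpha_i$ times, $z_\lambda=\prod_i i^{\alpha_i}\alpha_i!$. The Kazhdan–Lusztig polynomial $P_M(t)\in\mathbb Z[t]$ of a loopless matroid $M$ is the unique assignment such that: $P_M(t)=1$ if $\mathrm{rk}(M)=0$; $\deg P_M<\frac12\mathrm{rk}(M)$ if $\mathrm{rk}(M)>0$; and $t^{\mathrm{rk}(M)}P_M(t^{-1})=\sum_{F}\chi_{M|F}(t)\,P_{M/F}(t)$, the sum over all flats $F$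 of $M$, where $M|F$ is the restriction to $F$, $M/F$ the contraction by $F$, and $\chi$ the characteristic polynomial. The $Z$-polynomial is $Z_M(t)=\sum_F t^{\mathrm{rk}(F)}P_{M/F}(t)$, the sum over all flats $F$ of $M$. *)

theory Defs
  imports "HOL-Computational_Algebra.Polynomial" "HOL-Library.Multiset"
begin

section \<open>Matroids on finite ground sets, presented by their bases\<close>

record 'a matroid =
  ground :: "'a set"
  bases :: "'a set set"

locale matroid =
  fixes M :: "'a matroid"
  assumes finite_ground: "finite (ground M)"
    and bases_subset: "B \<in> bases M \<Longrightarrow> B \<subseteq> ground M"
    and bases_nonempty: "bases M \<noteq> {}"
    and basis_exchange:
      "\<lbrakk>B \<in> bases M; C \<in> bases M; x \<in> B - C\<rbrakk> \<Longrightarrow> \<exists>y\<in>C - B. insert y (B - {x}) \<in> bases M"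

definition rk :: "'a matroid \<Rightarrow> 'a set \<Rightarrow> nat" where
  "rk M A = Max ((\<lambda>B. card (B \<inter> A)) ` bases M)"

abbreviation rank :: "'a matroid \<Rightarrow> nat" where
  "rank M \<equiv> rk M (ground M)"

definition loopless :: "'a matroid \<Rightarrow> bool" where
  "loopless M \<longleftrightarrow> (\<forall>x\<in>ground M. \<exists>B\<in>bases M. x \<in> B)"

definition flats :: "'a matroid \<Rightarrow> 'a set set" where
  "flats M = {F. F \<subseteq> ground M \<and> (\<forall>x\<in>ground M - F. rk M F < rk M (insert x F))}"

text \<open>
  A basis \<open>B\<close> of \<open>M\<close> with \<open>card (B \<inter> A) = rk M A\<close> is one that extends a basis of \<open>A\<close>: its
  part inside \<open>A\<close> is a basis of the restriction to \<open>A\<close>, its part outside \<open>A\<close> is a basis of the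
  contraction by \<open>A\<close>, and all bases of these minors arise in this way.
\<close>

definition restriction :: "'a matroid \<Rightarrow> 'a set \<Rightarrow> 'a matroid" where
  "restriction M A =
    \<lparr>ground = ground M \<inter> A, bases = {B \<inter> A |B. B \<in> bases M \<and> card (B \<inter> A) = rk M A}\<rparr>"

definition contraction :: "'a matroid \<Rightarrow> 'a set \<Rightarrow> 'a matroid" where
  "contraction M A =
    \<lparr>ground = ground M - A, bases = {B - A |B. B \<in> bases M \<and> card (B \<inter> A) = rk M A}\<rparr>"

text \<open>
  The usual subset expansion; for loopless \<open>M\<close> it agrees with the Moebius-function
  definition over the lattice of flats.
\<close>

definition characteristic_poly :: "'a matroid \<Rightarrow> int poly" where
  "characteristic_poly M = (\<Sum>A\<in>Pow (ground M). monom ((-1) ^ card A) (rank M - rk M A))"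


section \<open>Kazhdan--Lusztig polynomials and Z-polynomials\<close>

text \<open>
  \<^term>\<open>reflect_poly p\<close> is \<open>t\<^sup>d p(1/t)\<close> with \<open>d = degree p\<close>; hence
  \<open>rev_poly r p\<close> is \<open>t\<^sup>r p(1/t)\<close> whenever \<open>degree p \<le> r\<close>.
\<close>

definition rev_poly :: "nat \<Rightarrow> int poly \<Rightarrow> int poly" where
  "rev_poly r p = monom 1 (r - degree p) * reflect_poly p"

definition kl_assignment :: "('a matroid \<Rightarrow> int poly) \<Rightarrow> bool" where
  "kl_assignment P \<longleftrightarrow>
    (\<forall>M. matroid M \<longrightarrow> loopless M \<longrightarrow>
      (rank M = 0 \<longrightarrow> P M = 1) \<and>
      (rank M > 0 \<longrightarrow> 2 * degree (P M) < rank M) \<and>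
      rev_poly (rank M) (P M) =
        (\<Sum>F\<in>flats M. characteristic_poly (restriction M F) * P (contraction M F)))"

text \<open>
  The class of loopless matroids with ground set in a fixed type is closed under restriction to
  and contraction by flats, so the conditions determine \<open>P\<close> on that class. The value \<open>0\<close>
  elsewhere only serves to make \<open>P\<close> unique as a total function.
\<close>

definition kl_poly :: "'a matroid \<Rightarrow> int poly" where
  "kl_poly = (THE P. kl_assignment P \<and> (\<forall>M. \<not> (matroid M \<and> loopless M) \<longrightarrow> P M = 0))"

definition Z_poly :: "'a matroid \<Rightarrow> int poly" where
  "Z_poly M = (\<Sum>F\<in>flats M. monom 1 (rk M F) * kl_poly (contraction M F))"


section \<open>Uniform, Schubert and Catalan matroids\<close>

definition uniform_matroid :: "nat \<Rightarrow> nat \<Rightarrow> nat matroid" where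
  "uniform_matroid r N = \<lparr>ground = {1..N}, bases = {T. T \<subseteq> {1..N} \<and> card T = r}\<rparr>"

definition schubert_matroid :: "nat \<Rightarrow> nat set \<Rightarrow> nat matroid" where
  "schubert_matroid N S =
    \<lparr>ground = {1..N},
     bases = {T. T \<subseteq> {1..N} \<and> card T = card S \<and>
       (\<forall>i<card S. sorted_list_of_set T ! i \<le> sorted_list_of_set S ! i)}\<rparr>"

text \<open>List positions start at \<open>0\<close>, the ground set \<open>{1..N}\<close> at \<open>1\<close>.\<close>

definition indicated_set :: "nat list \<Rightarrow> nat set" where
  "indicated_set v = {Suc i |i. i < length v \<and> v ! i = 1}"

definition catalan_matroid :: "nat \<Rightarrow> nat \<Rightarrow> nat \<Rightarrow> nat matroid" where
  "catalan_matroid a b n =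
    schubert_matroid (n * (a + b))
      (indicated_set (concat (replicate n (replicate a 0 @ replicate b 1))))"

definition uniform_ab :: "nat \<Rightarrow> nat \<Rightarrow> nat \<Rightarrow> nat matroid" where
  "uniform_ab a b m = uniform_matroid (m * b) (m * (a + b))"


section \<open>Integer partitions, as multisets of positive parts\<close>

definition partitions :: "nat \<Rightarrow> nat multiset set" where
  "partitions n = {l. sum_mset l = n \<and> 0 \<notin># l}"

lemma finite_partitions: "finite (partitions n)"
proof -
  have "partitions n \<subseteq> mset ` {xs. set xs \<subseteq> {..n} \<and> length xs \<le> n}"
  proof
    fix l assume l: "l \<in> partitions n"
    obtain xs where xs: "l = mset xs" by (metis ex_mset)
    have s: "sum_list xs = n" and z: "0 \<notin> set xs"
      using l by (auto simp: partitions_def xs sum_mset_sum_list)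
    have "length xs \<le> sum_list xs"
      using z by (induction xs) auto
    moreover have "set xs \<subseteq> {..n}"
      using s member_le_sum_list by auto
    ultimately show "l \<in> mset ` {xs. set xs \<subseteq> {..n} \<and> length xs \<le> n}"
      using s xs by auto
  qed
  then show ?thesis
    by (rule finite_subset) (simp add: finite_lists_length_le)
qed

definition z_part :: "nat multiset \<Rightarrow> nat" where
  "z_part l = (\<Prod>i\<in>set_mset l. i ^ count l i * fact (count l i))"

definition Z_uniform_part :: "nat \<Rightarrow> nat \<Rightarrow> nat multiset \<Rightarrow> int poly" where
  "Z_uniform_part a b l = (\<Prod>m\<in>#l. Z_poly (uniform_ab a b m))"

end

theory Submission
  imports Defs
begin

text \<open>
  A Kazhdan--Lusztig polynomial and a Z-polynomial exist for every monotone function \<open>r\<close> on the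
  subsets of a finite set: \<open>Z\<close> is the sum of \<open>t\<^sup>r P\<close> over all subsets, and it is made palindromic by
  the choice of \<open>P\<close>. For the rank function of a matroid only the flats contribute.

  Write \<open>y\<^sub>i(A)\<close> for the number of elements of \<open>A\<close> in the \<open>i\<close>-th block of \<open>a + b\<close> elements, minus
  \<open>b\<close>. Up to a constant the rank function of the Catalan matroid is
  \<open>min 0 (y\<^sub>1 + min 0 (y\<^sub>2 + \<dots>))\<close>, and that of the uniform matroid is \<open>min 0 (y\<^sub>1 + \<dots> + y\<^sub>n)\<close>.
  As \<open>x\<close> and \<open>y\<close> increase with \<open>A\<close>, at most one of \<open>x \<le> 0 < y\<close> and \<open>y \<le> 0 < x\<close> occurs along a chain of
  sets; hence \<open>Z\<close> takes the same total value on \<open>{min 0 x + min 0 y, min 0 (x + y)}\<close> and on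
  \<open>{min 0 (x + min 0 y), min 0 (min 0 x + y)}\<close>. This is a Rota--Baxter identity, and Spitzer's
  argument turns it into \<open>n Z(C\<^sub>n) = \<Sum>\<^sub>m Z(U\<^sub>m) Z(C\<^sub>n\<^sub>-\<^sub>m)\<close>. The sum over partitions satisfies the same
  recursion.
\<close>

section \<open>Reversal and truncation of polynomials\<close>

text \<open>The reversing length \<open>n\<close> is prescribed and does not depend on
  \<open>degree p\<close>, which makes the operation additive without side conditions; coefficients
  beyond \<open>n\<close> are dropped. For \<open>degree p \<le> n\<close> it is
  \<open>rev_poly n p\<close>.\<close>

definition reversal :: "nat \<Rightarrow> int poly \<Rightarrow> int poly" where
  "reversal n p = (\<Sum>i\<le>n. monom (coeff p (n - i)) i)"

text \<open>The bound is strict: the middle coefficient is cut off too, matching the degree bound of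
  Kazhdan-Lusztig polynomials.\<close>

definition lower_half :: "nat \<Rightarrow> int poly \<Rightarrow> int poly" where
  "lower_half n p = (\<Sum>i | 2 * i < n. monom (coeff p i) i)"

lemma coeff_reversal: "coeff (reversal n p) i = (if i \<le> n then coeff p (n - i) else 0)"
  by (simp add: reversal_def coeff_sum sum.delta)

lemma finite_lower_half: "finite {i::nat. 2 * i < n}"
  by (rule finite_subset[of _ "{..<n}"]) auto

lemma coeff_lower_half: "coeff (lower_half n p) i = (if 2 * i < n then coeff p i else 0)"
  by (simp add: lower_half_def coeff_sum sum.delta[OF finite_lower_half])

lemma reversal_add: "reversal n (p + q) = reversal n p + reversal n q"
  and reversal_diff: "reversal n (p - q) = reversal n p - reversal n q"
  and reversal_sum: "reversal n (\<Sum>x\<in>X. f x) = (\<Sum>x\<in>X. reversal n (f x))"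
  and lower_half_add: "lower_half n (p + q) = lower_half n p + lower_half n q"
  by (auto simp: poly_eq_iff coeff_reversal coeff_lower_half coeff_sum)

lemma degree_reversal: "degree (reversal n p) \<le> n"
  by (rule degree_le) (simp add: coeff_reversal)

lemma reversal_reversal: "degree p \<le> n \<Longrightarrow> reversal n (reversal n p) = p"
  by (auto simp: poly_eq_iff coeff_reversal coeff_eq_0)

lemma degree_lower_half: "n > 0 \<Longrightarrow> 2 * degree (lower_half n p) < n"
  by (cases "lower_half n p = 0")
    (simp, metis coeff_lower_half leading_coeff_neq_0)

lemma rev_poly_eq_reversal:
  assumes "degree p \<le> n"
  shows "rev_poly n p = reversal n p"
proof (rule poly_eqI)
  fix i
  show "coeff (rev_poly n p) i = coeff (reversal n p) i"
    using assms by (auto simp: rev_poly_def coeff_monom_mult coeff_reversal coeff_reflect_poly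
        intro!: coeff_eq_0 arg_cong[of _ _ "coeff p"])
qed

lemma reversal_mult:
  assumes "degree p \<le> m" "degree q \<le> n"
  shows "reversal (m + n) (p * q) = reversal m p * reversal n q"
proof (cases "p = 0 \<or> q = 0")
  case True
  then show ?thesis by (auto simp: reversal_def)
next
  case False
  then have "degree (p * q) = degree p + degree q"
    by (simp add: degree_mult_eq)
  moreover from this assms have "m + n - degree (p * q) = (m - degree p) + (n - degree q)"
    by simp
  ultimately have "rev_poly (m + n) (p * q) = rev_poly m p * rev_poly n q"
    using mult_monom[of "1::int" "m - degree p" 1 "n - degree q"]
    by (simp add: rev_poly_def reflect_poly_mult ac_simps)
  then show ?thesis
    using assms \<open>degree (p * q) = _\<close> by (simp add: rev_poly_eq_reversal)
qed

lemma reversal_monom_mult: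
  assumes "degree p \<le> n"
  shows "reversal (k + n) (monom 1 k * p) = reversal n p"
proof -
  have "reversal k (monom 1 k) = 1"
    by (auto simp: poly_eq_iff coeff_reversal)
  then show ?thesis
    using reversal_mult[of "monom 1 k" k p n] assms by (simp add: degree_monom_eq)
qed

text \<open>Coefficients \<open>i\<close> and \<open>n - i\<close> are opposite, so the middle one
  and all beyond \<open>n\<close> vanish, and the part below the middle determines the rest.\<close>

lemma antisymmetric_eq_lower_half:
  assumes "reversal n p = - p"
  shows "p = lower_half n p - reversal n (lower_half n p)"
proof (rule poly_eqI)
  fix i
  have *: "(if j \<le> n then coeff p (n - j) else 0) = - coeff p j" for j
    using arg_cong[OF assms, of "\<lambda>q. coeff q j"] by (simp add: coeff_reversal)
  have "2 * i = n \<Longrightarrow> n - i = i" by simp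
  then show "coeff p i = coeff (lower_half n p - reversal n (lower_half n p)) i"
    using *[of i] by (auto simp: coeff_reversal coeff_lower_half split: if_splits)
qed

text \<open>Under the degree bounds \<open>p\<close> lives strictly below the middle and
  \<open>reversal n p\<close> strictly above it, so nothing cancels in the difference. Both
  uniqueness proofs below rest on this.\<close>

lemma reversal_diff_inject:
  assumes "reversal n p - p = reversal n q - q" "2 * degree p < n" "2 * degree q < n"
  shows "p = q"
proof (rule poly_eqI)
  fix i
  have *: "coeff (reversal n p - p) i = coeff (reversal n q - q) i"
    using assms by simp
  have "coeff p j = 0" "coeff q j = 0" if "2 * j \<ge> n" for j
    using that assms by (auto intro!: coeff_eq_0)
  then show "coeff p i = coeff q i"
    using * by (cases "2 * i < n") (auto simp: coeff_reversal)
qed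

section \<open>Kazhdan--Lusztig and Z-polynomials of monotone set functions\<close>

text \<open>For the rank function of a matroid this is the Kazhdan-Lusztig polynomial of the
  contraction by \<open>A\<close> if \<open>A\<close> is a flat, and 0 otherwise. The sum
  \<open>s\<close> collects the strict supersets, and the value is chosen to make itself plus
  \<open>s\<close> palindromic. A proper subset of full rank is never a flat, hence the value 0;
  infinite \<open>E\<close> gets 0 so that \<open>card (E - A)\<close> decreases in every recursive
  call.\<close>

function boolean_kl :: "('a set \<Rightarrow> int) \<Rightarrow> 'a set \<Rightarrow> 'a set \<Rightarrow> int poly" where
  "boolean_kl r E A =
    (if A = E then 1 else if infinite E \<or> r A = r E then 0
     else let n = nat (r E - r A);
              s = (\<Sum>C | A \<subset> C \<and> C \<subseteq> E. monom 1 (nat (r C - r A)) * boolean_kl r E C)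
          in lower_half n (reversal n s - s))"
  by auto
termination
  by (relation "measure (\<lambda>(r, E, A). card (E - A))") (auto intro!: psubset_card_mono)

declare boolean_kl.simps [simp del]

text \<open>Only differences of \<open>r\<close> enter, so \<open>r\<close> may be integer-valued
  and shifted by a constant; it need not vanish at \<open>{}\<close>.\<close>

definition boolean_Z :: "('a set \<Rightarrow> int) \<Rightarrow> 'a set \<Rightarrow> 'a set \<Rightarrow> int poly" where
  "boolean_Z r E A = (\<Sum>C | A \<subseteq> C \<and> C \<subseteq> E. monom 1 (nat (r C - r A)) * boolean_kl r E C)"

lemma boolean_kl_top [simp]: "boolean_kl r E E = 1"
  by (simp add: boolean_kl.simps)

lemma boolean_kl_rank_0: "r A = r E \<Longrightarrow> A \<noteq> E \<Longrightarrow> boolean_kl r E A = 0"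
  by (simp add: boolean_kl.simps)

lemma finite_interval [simp]:
  "finite E \<Longrightarrow> finite {C. A \<subseteq> C \<and> C \<subseteq> E}"
  "finite E \<Longrightarrow> finite {C. A \<subset> C \<and> C \<subseteq> E}"
  by (rule finite_subset[of _ "Pow E"]; auto)+

lemma sum_interval_bot:
  assumes "finite E" "A \<subseteq> E"
  shows "(\<Sum>C | A \<subseteq> C \<and> C \<subseteq> E. f C) = f A + (\<Sum>C | A \<subset> C \<and> C \<subseteq> E. f C :: 'b::comm_monoid_add)"
proof -
  have "{C. A \<subseteq> C \<and> C \<subseteq> E} = insert A {C. A \<subset> C \<and> C \<subseteq> E}"
    using assms by auto
  then show ?thesis using assms by simp
qed

lemma boolean_Z_bot:
  assumes "finite E" "A \<subseteq> E"
  shows "boolean_Z r E A =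
    boolean_kl r E A + (\<Sum>C | A \<subset> C \<and> C \<subseteq> E. monom 1 (nat (r C - r A)) * boolean_kl r E C)"
  using assms by (simp add: boolean_Z_def sum_interval_bot)

lemma interval_induct [consumes 2, case_names step]:
  assumes "finite E" "A \<subseteq> E"
    and step: "\<And>A. A \<subseteq> E \<Longrightarrow> (\<And>C. A \<subset> C \<Longrightarrow> C \<subseteq> E \<Longrightarrow> Q C) \<Longrightarrow> Q A"
  shows "Q A"
  using assms(2)
proof (induction "card (E - A)" arbitrary: A rule: less_induct)
  case less
  show ?case
  proof (rule step[OF less.prems])
    fix C assume "A \<subset> C" "C \<subseteq> E"
    then show "Q C"
      using less assms(1) by (intro less.hyps) (auto intro!: psubset_card_mono)
  qed
qed

lemma degree_boolean_kl_less:
  assumes "r A < r E"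
  shows "2 * degree (boolean_kl r E A) < nat (r E - r A)"
proof -
  have "A \<noteq> E" using assms by auto
  then show ?thesis
    using assms by (subst boolean_kl.simps) (simp add: Let_def degree_lower_half)
qed

lemma degree_boolean_kl_le:
  assumes "r A \<le> r E"
  shows "degree (boolean_kl r E A) \<le> nat (r E - r A)"
  using degree_boolean_kl_less[of r A E] assms
  by (cases "r A = r E \<and> A \<noteq> E") (auto simp: boolean_kl_rank_0)

text \<open>No matroid axiom is needed: for monotone \<open>r\<close> the palindromic equation at \<open>A\<close> can
  always be solved for the value at \<open>A\<close>, because \<open>reversal n s - s\<close> is antisymmetric.\<close>

lemma reversal_boolean_Z:
  assumes "finite E" "mono_on (Pow E) r" "A \<subseteq> E"
  shows "reversal (nat (r E - r A)) (boolean_Z r E A) = boolean_Z r E A"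
proof (cases "A = E \<or> r A = r E")
  case True
  have r: "r C = r E" if "A \<subseteq> C" "C \<subseteq> E" for C
  proof -
    have "r A \<le> r C" "r C \<le> r E"
      using mono_onD[OF assms(2), of A C] mono_onD[OF assms(2), of C E] that by auto
    then show ?thesis using True that by force
  qed
  \<comment> \<open>On this interval every \<open>C\<close> has the rank of \<open>E\<close>, so all
    values except the one at \<open>C = E\<close> vanish.\<close>
  have "boolean_Z r E A = (\<Sum>C\<in>{C. A \<subseteq> C \<and> C \<subseteq> E}. if C = E then 1 else 0)"
    unfolding boolean_Z_def
  proof (intro sum.cong refl)
    fix C assume "C \<in> {C. A \<subseteq> C \<and> C \<subseteq> E}"
    then have "r C = r A" "r C = r E"
      using r[of C] r[of A] assms(3) by auto
    then show "monom 1 (nat (r C - r A)) * boolean_kl r E C = (if C = E then 1 else 0)"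
      by (cases "C = E") (simp_all add: boolean_kl_rank_0)
  qed
  also have "\<dots> = 1"
    using assms by simp
  finally show ?thesis
    using r[of A] assms by (auto simp: poly_eq_iff coeff_reversal)
next
  case False
  define n where "n = nat (r E - r A)"
  define s where "s = (\<Sum>C | A \<subset> C \<and> C \<subseteq> E. monom 1 (nat (r C - r A)) * boolean_kl r E C)"
  define p where "p = boolean_kl r E A"
  have p: "p = lower_half n (reversal n s - s)"
    unfolding p_def n_def s_def using False assms by (subst boolean_kl.simps) (simp add: Let_def)
  have "degree (monom 1 (nat (r C - r A)) * boolean_kl r E C) \<le> n" if "A \<subset> C" "C \<subseteq> E" for C
  proof -
    have "r A \<le> r C" "r C \<le> r E"
      using that mono_onD[OF assms(2), of A C] mono_onD[OF assms(2), of C E] by auto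
    then show ?thesis
      using degree_boolean_kl_le[of r C E] unfolding n_def
      by (intro order.trans[OF degree_mult_le]) (auto simp: degree_monom_eq)
  qed
  \<comment> \<open>The degree bound makes reversal an involution on \<open>s\<close>, whence the
    antisymmetry.\<close>
  then have "degree s \<le> n"
    unfolding s_def using assms by (intro degree_sum_le) auto
  then have "reversal n (reversal n s - s) = - (reversal n s - s)"
    by (simp add: reversal_diff reversal_reversal)
  from antisymmetric_eq_lower_half[OF this] have "reversal n s - s = p - reversal n p"
    by (simp add: p)
  then have "reversal n (p + s) = p + s"
    by (simp add: reversal_add algebra_simps)
  then show ?thesis
    using assms by (simp add: boolean_Z_bot n_def p_def s_def)
qed

text \<open>Downward induction from \<open>E\<close>: once the values above \<open>A\<close> agree,
  palindromicity at \<open>A\<close> fixes the reversal minus the value, and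
  \<open>reversal_diff_inject\<close> recovers the value. It serves to recognise products in
  \<open>boolean_Z_direct_sum\<close>.\<close>

lemma boolean_kl_unique:
  assumes "finite E" "mono_on (Pow E) r"
    and top: "p E = 1"
    and zero: "\<And>A. A \<subset> E \<Longrightarrow> r A = r E \<Longrightarrow> p A = 0"
    and deg: "\<And>A. A \<subseteq> E \<Longrightarrow> r A < r E \<Longrightarrow> 2 * degree (p A) < nat (r E - r A)"
    and palindromic: "\<And>A. A \<subseteq> E \<Longrightarrow> reversal (nat (r E - r A))
        (\<Sum>C | A \<subseteq> C \<and> C \<subseteq> E. monom 1 (nat (r C - r A)) * p C) =
        (\<Sum>C | A \<subseteq> C \<and> C \<subseteq> E. monom 1 (nat (r C - r A)) * p C)"
    and "A \<subseteq> E"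
  shows "p A = boolean_kl r E A"
  using \<open>finite E\<close> \<open>A \<subseteq> E\<close>
proof (induction A rule: interval_induct)
  case (step A)
  show ?case
  proof (cases "A = E \<or> r A = r E")
    case True
    then show ?thesis
      using step.hyps top zero by (cases "A = E") (simp_all add: boolean_kl_rank_0 psubset_eq)
  next
    case False
    then have less: "r A < r E"
      using mono_onD[OF assms(2), of A E] step.hyps by auto
    define n where "n = nat (r E - r A)"
    define s where "s = (\<Sum>C | A \<subset> C \<and> C \<subseteq> E. monom 1 (nat (r C - r A)) * boolean_kl r E C)"
    have "(\<Sum>C | A \<subset> C \<and> C \<subseteq> E. monom 1 (nat (r C - r A)) * p C) = s"
      unfolding s_def using step.IH by (intro sum.cong) auto
    then have "reversal n (p A + s) = p A + s"
      using palindromic[OF step.hyps] assms(1) step.hyps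
      by (simp add: sum_interval_bot n_def)
    moreover have "reversal n (boolean_kl r E A + s) = boolean_kl r E A + s"
      using reversal_boolean_Z[OF assms(1,2) step.hyps] assms(1) step.hyps
      by (simp add: boolean_Z_bot n_def s_def)
    ultimately have "reversal n (p A) - p A = reversal n (boolean_kl r E A) - boolean_kl r E A"
      by (simp add: reversal_add)
    then show ?thesis
      by (rule reversal_diff_inject)
        (use deg[OF step.hyps less] degree_boolean_kl_less[OF less] in \<open>simp_all add: n_def\<close>)
  qed
qed

text \<open>The recursion sees only the interval above \<open>A\<close> and the rank differences in
  it. The map \<open>h\<close> acts on sets, not on elements, so that relabelling (\<open>h\<close>
  takes images) and contraction (\<open>h\<close> adds a fixed set) are both instances.\<close>

lemma boolean_kl_transport:
  assumes "finite E" "finite E'" "A0 \<subseteq> E"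
    and inj: "inj_on h {C. A0 \<subseteq> C \<and> C \<subseteq> E}"
    and mono: "\<And>C D. \<lbrakk>A0 \<subseteq> C; C \<subseteq> E; A0 \<subseteq> D; D \<subseteq> E\<rbrakk> \<Longrightarrow> h C \<subseteq> h D \<longleftrightarrow> C \<subseteq> D"
    and image: "h ` {C. A0 \<subseteq> C \<and> C \<subseteq> E} = {C. A0' \<subseteq> C \<and> C \<subseteq> E'}"
    and rank: "\<And>C D. \<lbrakk>A0 \<subseteq> C; C \<subseteq> D; D \<subseteq> E\<rbrakk> \<Longrightarrow> r' (h D) - r' (h C) = r D - r C"
    and "A0 \<subseteq> A" "A \<subseteq> E"
  shows "boolean_kl r' E' (h A) = boolean_kl r E A"
proof -
  have "h A0 \<in> h ` {C. A0 \<subseteq> C \<and> C \<subseteq> E}"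
    using assms(3) by auto
  then have "E' \<in> h ` {C. A0 \<subseteq> C \<and> C \<subseteq> E}"
    unfolding image by auto
  have top: "h E = E'"
  proof
    obtain C where C: "C \<subseteq> E" "A0 \<subseteq> C" "h C = E'"
      using \<open>E' \<in> _\<close> by auto
    then show "E' \<subseteq> h E"
      using mono[of C E] assms(3) by simp
    have "h E \<in> {C. A0' \<subseteq> C \<and> C \<subseteq> E'}"
      unfolding image[symmetric] using assms(3) by auto
    then show "h E \<subseteq> E'" by simp
  qed
  have sub: "h ` {C. A \<subset> C \<and> C \<subseteq> E} = {C. h A \<subset> C \<and> C \<subseteq> E'}"
    if "A0 \<subseteq> A" "A \<subseteq> E" for A
  proof (intro equalityI subsetI)
    fix C assume "C \<in> h ` {C. A \<subset> C \<and> C \<subseteq> E}"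
    then obtain D where "C = h D" "A \<subset> D" "D \<subseteq> E" by auto
    moreover have "h D \<in> {C. A0' \<subseteq> C \<and> C \<subseteq> E'}"
      unfolding image[symmetric] using calculation that by auto
    ultimately show "C \<in> {C. h A \<subset> C \<and> C \<subseteq> E'}"
      using that mono[of A D] mono[of D A] by auto
  next
    fix C assume C: "C \<in> {C. h A \<subset> C \<and> C \<subseteq> E'}"
    have "h A \<in> {C. A0' \<subseteq> C \<and> C \<subseteq> E'}"
      unfolding image[symmetric] using that by auto
    then have "C \<in> h ` {C. A0 \<subseteq> C \<and> C \<subseteq> E}"
      unfolding image using C by auto
    then obtain D where "C = h D" "A0 \<subseteq> D" "D \<subseteq> E" by auto
    then show "C \<in> h ` {C. A \<subset> C \<and> C \<subseteq> E}"
      using C that mono[of A D] by auto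
  qed
  have "A0 \<subseteq> A \<longrightarrow> boolean_kl r' E' (h A) = boolean_kl r E A"
    using \<open>finite E\<close> \<open>A \<subseteq> E\<close>
  proof (induction A rule: interval_induct)
    case (step A)
    show ?case
    proof
      assume A: "A0 \<subseteq> A"
      have eq: "h A = E' \<longleftrightarrow> A = E"
        using top inj A step.hyps by (auto dest: inj_onD)
      have req: "r' E' - r' (h A) = r E - r A"
        using rank[of A E] A step.hyps top by simp
      have "(\<Sum>C | h A \<subset> C \<and> C \<subseteq> E'. monom 1 (nat (r' C - r' (h A))) * boolean_kl r' E' C) =
        (\<Sum>C | A \<subset> C \<and> C \<subseteq> E. monom 1 (nat (r' (h C) - r' (h A))) * boolean_kl r' E' (h C))"
        using inj A by (subst sub[OF A step.hyps, symmetric], subst sum.reindex)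
          (auto intro: inj_on_subset)
      also have "\<dots> = (\<Sum>C | A \<subset> C \<and> C \<subseteq> E. monom 1 (nat (r C - r A)) * boolean_kl r E C)"
        using step.IH A by (intro sum.cong) (auto simp: rank psubset_eq)
      finally show "boolean_kl r' E' (h A) = boolean_kl r E A"
        using eq req assms(1,2)
        by (subst (1 2) boolean_kl.simps) (auto simp: Let_def)
    qed
  qed
  then show ?thesis using \<open>A0 \<subseteq> A\<close> by simp
qed

lemma boolean_kl_cong:
  assumes "finite E" "A \<subseteq> E" "\<And>C. C \<subseteq> E \<Longrightarrow> A \<subseteq> C \<Longrightarrow> r C = r' C"
  shows "boolean_kl r E A = boolean_kl r' E A"
  using assms by (intro boolean_kl_transport[where h = "\<lambda>A. A" and ?A0.0 = A]) auto

lemma inj_on_image_subset_iff: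
  assumes "inj_on f E" "A \<subseteq> E" "B \<subseteq> E"
  shows "f ` A \<subseteq> f ` B \<longleftrightarrow> A \<subseteq> B"
  using assms by (metis image_mono inj_on_image_mem_iff image_subset_iff subset_iff)

text \<open>Relabelling of the ground set; \<open>k\<close> absorbs the additive constant between a
  matroid rank and its normalised form.\<close>

lemma boolean_Z_transport:
  assumes "finite E" "inj_on f E"
    and rank: "\<And>A. A \<subseteq> E \<Longrightarrow> r' (f ` A) = r A + k"
  shows "boolean_Z r' (f ` E) {} = boolean_Z r E {}"
proof -
  have inj: "inj_on ((`) f) (Pow E)"
    using assms(2) by (rule inj_on_image_Pow)
  have img: "{C. C \<subseteq> f ` E} = (`) f ` {C. C \<subseteq> E}"
    by (auto simp: subset_image_iff)
  have kl: "boolean_kl r' (f ` E) (f ` A) = boolean_kl r E A" if "A \<subseteq> E" for A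
    using assms(1) that inj img
    by (intro boolean_kl_transport[where ?A0.0 = "{}" and ?A0'.0 = "{}"])
      (auto simp: rank Pow_def inj_on_image_subset_iff[OF assms(2)])
  have "boolean_Z r' (f ` E) {} = (\<Sum>C | C \<subseteq> E. monom 1 (nat (r' (f ` C) - r' {})) * boolean_kl r' (f ` E) (f ` C))"
    using inj by (simp add: boolean_Z_def img sum.reindex Pow_def)
  also have "\<dots> = boolean_Z r E {}"
    using rank[of "{}"] by (auto simp: boolean_Z_def kl rank intro!: sum.cong)
  finally show ?thesis .
qed

lemma boolean_Z_cong:
  assumes "finite E" "\<And>A. A \<subseteq> E \<Longrightarrow> r A = r' A"
  shows "boolean_Z r E {} = boolean_Z r' E {}"
  using boolean_Z_transport[of E "\<lambda>x. x" r r' 0] assms by simp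

text \<open>A chain of subsets cannot meet both \<open>X - Y\<close> and \<open>Y - X\<close>, so along each chain the four
  functions agree in pairs. This is the only instance of valuativity that is needed.\<close>

lemma boolean_Z_four_term:
  fixes r1 r2 r3 r4 :: "'a set \<Rightarrow> int"
  assumes "finite E"
    and up: "\<And>A B. A \<subseteq> B \<Longrightarrow> B \<subseteq> E \<Longrightarrow> X A \<Longrightarrow> X B"
      "\<And>A B. A \<subseteq> B \<Longrightarrow> B \<subseteq> E \<Longrightarrow> Y A \<Longrightarrow> Y B"
    and pair1: "\<And>A. A \<subseteq> E \<Longrightarrow> X A \<or> \<not> Y A \<Longrightarrow> r1 A = r4 A \<and> r2 A = r3 A"
    and pair2: "\<And>A. A \<subseteq> E \<Longrightarrow> Y A \<or> \<not> X A \<Longrightarrow> r1 A = r3 A \<and> r2 A = r4 A"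
    and top: "X E" "Y E"
  shows "boolean_Z r1 E {} + boolean_Z r2 E {} = boolean_Z r3 E {} + boolean_Z r4 E {}"
proof -
  let ?t = "\<lambda>r A C. monom 1 (nat (r C - r A)) * boolean_kl r E C"
  \<comment> \<open>Upward closure extends \<open>X A\<close> to the whole interval above
    \<open>A\<close>, where the functions agree in the pairing of \<open>pair1\<close>.\<close>
  have X: "boolean_kl r1 E A = boolean_kl r4 E A \<and> boolean_kl r2 E A = boolean_kl r3 E A"
    if "A \<subseteq> E" "X A" for A
    using that pair1 up(1) assms(1) by (auto intro!: boolean_kl_cong)
  have Y: "boolean_kl r1 E A = boolean_kl r3 E A \<and> boolean_kl r2 E A = boolean_kl r4 E A"
    if "A \<subseteq> E" "Y A" for A
    using that pair2 up(2) assms(1) by (auto intro!: boolean_kl_cong)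
  \<comment> \<open>Where \<open>X\<close> and \<open>Y\<close> agree, both pairings hold and all
    four functions coincide.\<close>
  have same: "r1 A = r4 A" "r2 A = r4 A" "r3 A = r4 A" if "A \<subseteq> E" "X A = Y A" for A
    using that pair1[OF that(1)] pair2[OF that(1)] by metis+
  \<comment> \<open>All exponents start from the common value at \<open>A\<close>. If
    \<open>X C\<close> or \<open>Y C\<close> holds, the four terms match in pairs; otherwise the
    ranks at \<open>C\<close> are equal too and \<open>IH\<close> applies.\<close>
  have summand: "?t r1 A C + ?t r2 A C = ?t r3 A C + ?t r4 A C"
    if "A \<subseteq> E" "\<not> X A" "\<not> Y A" "C \<subseteq> E"
      and IH: "\<not> X C \<Longrightarrow> \<not> Y C \<Longrightarrow> boolean_kl r1 E C + boolean_kl r2 E C = boolean_kl r3 E C + boolean_kl r4 E C"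
    for A C
  proof -
    consider "X C" | "Y C" | "\<not> X C" "\<not> Y C" by blast
    then show ?thesis
    proof cases
      case 1
      then show ?thesis using X[of C] same[of A] pair1[of C] that by simp
    next
      case 2
      then show ?thesis using Y[of C] same[of A] pair2[of C] that by simp
    next
      case 3
      then show ?thesis using IH same[of A] same[of C] that
        by (simp add: distrib_left[symmetric])
    qed
  qed
  have kl: "boolean_kl r1 E A + boolean_kl r2 E A = boolean_kl r3 E A + boolean_kl r4 E A"
    if "A \<subseteq> E" for A
    using \<open>finite E\<close> that
  proof (induction A rule: interval_induct)
    case (step A)
    show ?case
    proof (cases "X A \<or> Y A")
      case True
      then show ?thesis using X[of A] Y[of A] step.hyps by auto
    next
      case False
      define n where "n = nat (r4 E - r4 A)"
      define s where "s = (\<lambda>r. \<Sum>C | A \<subset> C \<and> C \<subseteq> E. ?t r A C)"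
      have "s r1 + s r2 = s r3 + s r4"
        using step False by (auto simp: s_def sum.distrib[symmetric] intro!: sum.cong summand)
      then have "reversal n (s r1) - s r1 + (reversal n (s r2) - s r2) =
          reversal n (s r3) - s r3 + (reversal n (s r4) - s r4)"
        by (metis add_diff_add reversal_add)
      then have *: "lower_half n (reversal n (s r1) - s r1) + lower_half n (reversal n (s r2) - s r2) =
          lower_half n (reversal n (s r3) - s r3) + lower_half n (reversal n (s r4) - s r4)"
        by (metis lower_half_add)
      \<comment> \<open>Both conditions hold at \<open>E\<close> and both fail at \<open>A\<close>,
        so the four functions share their values at both ends and hence the length
        \<open>n\<close>.\<close>
      have "A \<noteq> E" using False top by auto
      have eq: "r1 A = r4 A" "r2 A = r4 A" "r3 A = r4 A" "r1 E = r4 E" "r2 E = r4 E" "r3 E = r4 E"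
        using same[of A] same[of E] step.hyps False top by auto
      show ?thesis
      proof (cases "r4 A = r4 E")
        case True
        then show ?thesis using eq \<open>A \<noteq> E\<close> by (simp add: boolean_kl_rank_0)
      next
        case False
        then have "boolean_kl r E A = lower_half n (reversal n (s r) - s r)" if "r A = r4 A" "r E = r4 E" for r
          using that \<open>A \<noteq> E\<close> assms(1) unfolding n_def s_def
          by (subst boolean_kl.simps) (simp add: Let_def)
        then show ?thesis using * eq by simp
      qed
    qed
  qed
  show ?thesis
  proof (cases "X {} \<or> Y {}")
    case True
    \<comment> \<open>If one condition holds already at \<open>{}\<close>, it holds everywhere and a
      single pairing suffices.\<close>
    then have "(\<forall>A\<subseteq>E. X A) \<or> (\<forall>A\<subseteq>E. Y A)"
      using up by (meson empty_subsetI)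
    then show ?thesis
    proof
      assume *: "\<forall>A\<subseteq>E. X A"
      have "boolean_Z r1 E {} = boolean_Z r4 E {}" "boolean_Z r2 E {} = boolean_Z r3 E {}"
        by (rule boolean_Z_cong; use assms(1) * pair1 in blast)+
      then show ?thesis by simp
    next
      assume *: "\<forall>A\<subseteq>E. Y A"
      have "boolean_Z r1 E {} = boolean_Z r3 E {}" "boolean_Z r2 E {} = boolean_Z r4 E {}"
        by (rule boolean_Z_cong; use assms(1) * pair2 in blast)+
      then show ?thesis by simp
    qed
  next
    case False
    then show ?thesis
      using kl by (auto simp: boolean_Z_def sum.distrib[symmetric] intro!: sum.cong summand)
  qed
qed

section \<open>Direct sums\<close>

lemma sum_interval_Un:
  fixes f g :: "'a set \<Rightarrow> 'b::comm_semiring_0"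
  assumes "E1 \<inter> E2 = {}" "A \<subseteq> E1 \<union> E2"
  shows "(\<Sum>C | A \<subseteq> C \<and> C \<subseteq> E1 \<union> E2. f (C \<inter> E1) * g (C \<inter> E2)) =
    (\<Sum>C | A \<inter> E1 \<subseteq> C \<and> C \<subseteq> E1. f C) * (\<Sum>C | A \<inter> E2 \<subseteq> C \<and> C \<subseteq> E2. g C)"
proof -
  have "(\<Sum>C | A \<subseteq> C \<and> C \<subseteq> E1 \<union> E2. f (C \<inter> E1) * g (C \<inter> E2)) =
    (\<Sum>(C, D)\<in>{C. A \<inter> E1 \<subseteq> C \<and> C \<subseteq> E1} \<times> {C. A \<inter> E2 \<subseteq> C \<and> C \<subseteq> E2}. f C * g D)"
    using assms
    by (intro sum.reindex_bij_witness[where i = "\<lambda>(C, D). C \<union> D" and j = "\<lambda>C. (C \<inter> E1, C \<inter> E2)"])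
      (auto; (rule arg_cong2[where f = "\<lambda>C D. f C * g D"])?; blast)+
  then show ?thesis
    by (simp add: sum_product sum.cartesian_product)
qed

text \<open>The products of the two Kazhdan-Lusztig polynomials satisfy the conditions of
  \<open>boolean_kl_unique\<close>: the Z-sum over an interval of the union factors, and a product
  of palindromic polynomials is palindromic.\<close>

lemma boolean_Z_direct_sum:
  assumes fin: "finite E1" "finite E2" and disj: "E1 \<inter> E2 = {}"
    and mono: "mono_on (Pow E1) r1" "mono_on (Pow E2) r2"
  shows "boolean_Z (\<lambda>A. r1 (A \<inter> E1) + r2 (A \<inter> E2)) (E1 \<union> E2) {} =
    boolean_Z r1 E1 {} * boolean_Z r2 E2 {}"
proof -
  let ?E = "E1 \<union> E2"
  let ?r = "\<lambda>A. r1 (A \<inter> E1) + r2 (A \<inter> E2)"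
  let ?p = "\<lambda>A. boolean_kl r1 E1 (A \<inter> E1) * boolean_kl r2 E2 (A \<inter> E2)"
  have r1: "r1 A \<le> r1 B" if "A \<subseteq> B" "B \<subseteq> E1" for A B
    using mono_onD[OF mono(1), of A B] that by auto
  have r2: "r2 A \<le> r2 B" if "A \<subseteq> B" "B \<subseteq> E2" for A B
    using mono_onD[OF mono(2), of A B] that by auto
  have top: "?E \<inter> E1 = E1" "?E \<inter> E2 = E2" using disj by auto
  have mono': "mono_on (Pow ?E) ?r"
    by (intro mono_onI add_mono r1 r2) auto
  have Z: "(\<Sum>C | A \<subseteq> C \<and> C \<subseteq> ?E. monom 1 (nat (?r C - ?r A)) * ?p C) =
      boolean_Z r1 E1 (A \<inter> E1) * boolean_Z r2 E2 (A \<inter> E2)" if "A \<subseteq> ?E" for A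
  proof -
    have "monom 1 (nat (?r C - ?r A)) * ?p C =
      (monom 1 (nat (r1 (C \<inter> E1) - r1 (A \<inter> E1))) * boolean_kl r1 E1 (C \<inter> E1)) *
      (monom 1 (nat (r2 (C \<inter> E2) - r2 (A \<inter> E2))) * boolean_kl r2 E2 (C \<inter> E2))"
      if "A \<subseteq> C" "C \<subseteq> ?E" for C
    proof -
      have "r1 (A \<inter> E1) \<le> r1 (C \<inter> E1)" "r2 (A \<inter> E2) \<le> r2 (C \<inter> E2)"
        using that by (auto intro!: r1 r2)
      then have "nat (?r C - ?r A) =
        nat (r1 (C \<inter> E1) - r1 (A \<inter> E1)) + nat (r2 (C \<inter> E2) - r2 (A \<inter> E2))" by simp
      then show ?thesis
        using mult_monom[of "1::int" "nat (r1 (C \<inter> E1) - r1 (A \<inter> E1))" 1 "nat (r2 (C \<inter> E2) - r2 (A \<inter> E2))"]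
        by (simp add: ac_simps)
    qed
    then have "(\<Sum>C | A \<subseteq> C \<and> C \<subseteq> ?E. monom 1 (nat (?r C - ?r A)) * ?p C) =
      (\<Sum>C | A \<subseteq> C \<and> C \<subseteq> ?E.
        (monom 1 (nat (r1 (C \<inter> E1) - r1 (A \<inter> E1))) * boolean_kl r1 E1 (C \<inter> E1)) *
        (monom 1 (nat (r2 (C \<inter> E2) - r2 (A \<inter> E2))) * boolean_kl r2 E2 (C \<inter> E2)))"
      by (intro sum.cong) auto
    then show ?thesis
      using sum_interval_Un[OF disj that,
          of "\<lambda>C. monom 1 (nat (r1 C - r1 (A \<inter> E1))) * boolean_kl r1 E1 C"
             "\<lambda>C. monom 1 (nat (r2 C - r2 (A \<inter> E2))) * boolean_kl r2 E2 C"]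
      by (simp add: boolean_Z_def)
  qed
  have "?p A = boolean_kl ?r ?E A" if "A \<subseteq> ?E" for A
  proof (rule boolean_kl_unique[OF _ mono', where p = ?p])
    show "finite ?E" using fin by simp
    show "?p ?E = 1" by (simp add: top)
    show "A \<subseteq> ?E" by fact
  next
    fix A assume A: "A \<subset> ?E" "?r A = ?r ?E"
    have "r1 (A \<inter> E1) \<le> r1 E1" "r2 (A \<inter> E2) \<le> r2 E2"
      by (auto intro!: r1 r2)
    then have "r1 (A \<inter> E1) = r1 E1" "r2 (A \<inter> E2) = r2 E2"
      using A(2) by (auto simp: top)
    moreover have "A \<inter> E1 \<noteq> E1 \<or> A \<inter> E2 \<noteq> E2"
      using A(1) by blast
    ultimately show "?p A = 0"
      using boolean_kl_rank_0[of r1 "A \<inter> E1" E1] boolean_kl_rank_0[of r2 "A \<inter> E2" E2] by fastforce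
  next
    fix A assume A: "A \<subseteq> ?E" "?r A < ?r ?E"
    have le: "r1 (A \<inter> E1) \<le> r1 E1" "r2 (A \<inter> E2) \<le> r2 E2"
      by (auto intro!: r1 r2)
    \<comment> \<open>A factor with zero rank difference is the constant 1 or 0. As the total rank
      difference is positive, at least one strict bound is available.\<close>
    have "2 * degree (boolean_kl r E B) < nat (r E - r B) \<or> degree (boolean_kl r E B) = 0"
      if "r B \<le> r E" for r and E B :: "'a set"
      using that degree_boolean_kl_less[of r B E]
      by (cases "r B = r E"; cases "B = E") (auto simp: boolean_kl_rank_0)
    from this[OF le(1)] this[OF le(2)]
    have "2 * degree (boolean_kl r1 E1 (A \<inter> E1)) + 2 * degree (boolean_kl r2 E2 (A \<inter> E2)) <
        nat (?r ?E - ?r A)"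
      using A(2) le by (auto simp: top)
    moreover have "degree (?p A) \<le> degree (boolean_kl r1 E1 (A \<inter> E1)) + degree (boolean_kl r2 E2 (A \<inter> E2))"
      by (rule degree_mult_le)
    ultimately show "2 * degree (?p A) < nat (?r ?E - ?r A)" by linarith
  next
    fix A assume A: "A \<subseteq> ?E"
    have le: "r1 (A \<inter> E1) \<le> r1 E1" "r2 (A \<inter> E2) \<le> r2 E2"
      by (auto intro!: r1 r2)
    then have n: "nat (?r ?E - ?r A) = nat (r1 E1 - r1 (A \<inter> E1)) + nat (r2 E2 - r2 (A \<inter> E2))"
      by (simp add: top)
    have sym: "reversal (nat (r1 E1 - r1 (A \<inter> E1))) (boolean_Z r1 E1 (A \<inter> E1)) = boolean_Z r1 E1 (A \<inter> E1)"
      "reversal (nat (r2 E2 - r2 (A \<inter> E2))) (boolean_Z r2 E2 (A \<inter> E2)) = boolean_Z r2 E2 (A \<inter> E2)"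
      using fin mono by (auto intro!: reversal_boolean_Z)
    \<comment> \<open>Being fixed by a reversal bounds the degree, as \<open>reversal_mult\<close>
      requires.\<close>
    then have "degree (boolean_Z r1 E1 (A \<inter> E1)) \<le> nat (r1 E1 - r1 (A \<inter> E1))"
      "degree (boolean_Z r2 E2 (A \<inter> E2)) \<le> nat (r2 E2 - r2 (A \<inter> E2))"
      by (metis degree_reversal)+
    then show "reversal (nat (?r ?E - ?r A)) (\<Sum>C | A \<subseteq> C \<and> C \<subseteq> ?E. monom 1 (nat (?r C - ?r A)) * ?p C) =
      (\<Sum>C | A \<subseteq> C \<and> C \<subseteq> ?E. monom 1 (nat (?r C - ?r A)) * ?p C)"
      unfolding Z[OF A] n by (simp add: reversal_mult sym)
  qed
  then show ?thesis
    using Z[of "{}"] by (simp add: boolean_Z_def)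
qed

section \<open>Matroids, their minors and Kazhdan--Lusztig polynomials\<close>

lemma card_insert_Diff_Int_ge:
  assumes "finite B" "x \<notin> A \<or> y \<in> A" "x \<in> B" "y \<notin> B"
  shows "card (B \<inter> A) \<le> card (insert y (B - {x}) \<inter> A)"
proof (cases "x \<in> A")
  case False
  then show ?thesis using assms by (intro card_mono) auto
next
  case True
  then have "insert y (B - {x}) \<inter> A = insert y (B \<inter> A - {x})" using assms by auto
  moreover have "Suc (card (B \<inter> A - {x})) = card (B \<inter> A)"
    using assms True by (intro card_Suc_Diff1) auto
  ultimately show ?thesis using assms by simp
qed

context matroid
begin

lemma finite_bases: "finite (bases M)"
  by (rule finite_subset[of _ "Pow (ground M)"]) (use bases_subset finite_ground in auto)

lemma finite_basis: "B \<in> bases M \<Longrightarrow> finite B"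
  using bases_subset finite_ground finite_subset by blast

text \<open>Exchanging elements of \<open>B - C\<close> for elements of \<open>C - B\<close> keeps
  the size and ends with a subset of \<open>C\<close>.\<close>

lemma card_bases_le: "B \<in> bases M \<Longrightarrow> C \<in> bases M \<Longrightarrow> card B \<le> card C"
proof (induction "card (B - C)" arbitrary: B rule: less_induct)
  case less
  show ?case
  proof (cases "B \<subseteq> C")
    case True
    then show ?thesis using finite_basis less.prems by (simp add: card_mono)
  next
    case False
    then obtain x where x: "x \<in> B - C" by auto
    then obtain y where y: "y \<in> C - B" "insert y (B - {x}) \<in> bases M"
      using basis_exchange less.prems by blast
    have fin: "finite B" using finite_basis less.prems by auto
    have "card (insert y (B - {x}) - C) < card (B - C)"
    proof -
      have "insert y (B - {x}) - C = B - C - {x}" using y by auto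
      then show ?thesis using x fin by (simp only:) (rule card_Diff1_less; auto)
    qed
    then have "card (insert y (B - {x})) \<le> card C"
      using less y by blast
    moreover have "card (insert y (B - {x})) = card B"
      using x y fin by (metis DiffD1 DiffD2 card_Suc_Diff1 card_insert_disjoint finite_Diff)
    ultimately show ?thesis by simp
  qed
qed

lemma card_bases: "B \<in> bases M \<Longrightarrow> C \<in> bases M \<Longrightarrow> card B = card C"
  by (simp add: card_bases_le order_antisym)

lemma card_Int_le_rk: "B \<in> bases M \<Longrightarrow> card (B \<inter> A) \<le> rk M A"
  unfolding rk_def using finite_bases by (intro Max_ge) auto

lemma rk_attained: "\<exists>B\<in>bases M. card (B \<inter> A) = rk M A"
proof -
  have "rk M A \<in> (\<lambda>B. card (B \<inter> A)) ` bases M"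
    unfolding rk_def using finite_bases bases_nonempty by (intro Max_in) auto
  then show ?thesis by auto
qed

lemma rk_mono: "A \<subseteq> C \<Longrightarrow> rk M A \<le> rk M C"
  using rk_attained[of A] card_Int_le_rk[of _ C] finite_basis
  by (metis Int_mono card_mono finite_Int order.trans subset_refl)

lemma rk_empty [simp]: "rk M {} = 0"
  using rk_attained[of "{}"] by auto

text \<open>Take \<open>B1\<close> attaining the rank of \<open>A\<close> and \<open>B2\<close> that
  of \<open>C\<close>, with the largest intersection. Exchanging an element of
  \<open>B1 - B2\<close> outside \<open>C\<close> would lose nothing on \<open>A\<close> and enlarge
  the intersection, so \<open>B1 - B2 \<subseteq> C\<close>; comparing sizes, \<open>B1\<close>
  attains the rank of \<open>C\<close> too. This takes the place of submodularity.\<close>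

lemma basis_attaining_chain:
  assumes "A \<subseteq> C"
  shows "\<exists>B\<in>bases M. card (B \<inter> A) = rk M A \<and> card (B \<inter> C) = rk M C"
proof -
  define Q where "Q = (\<lambda>(B1, B2). B1 \<in> bases M \<and> B2 \<in> bases M \<and>
    card (B1 \<inter> A) = rk M A \<and> card (B2 \<inter> C) = rk M C)"
  obtain B1 B2 where "Q (B1, B2)"
    unfolding Q_def using rk_attained[of A] rk_attained[of C] by auto
  moreover have "\<forall>p. Q p \<longrightarrow> card (fst p \<inter> snd p) \<le> card (ground M)"
    using bases_subset finite_ground by (auto simp: Q_def intro!: card_mono)
  then have "\<forall>p. Q p \<longrightarrow> card (fst p \<inter> snd p) < Suc (card (ground M))"
    by (simp add: less_Suc_eq_le)
  ultimately have "\<exists>p. Q p \<and> (\<forall>q. Q q \<longrightarrow> card (fst q \<inter> snd q) \<le> card (fst p \<inter> snd p))"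
    by (rule ex_has_greatest_nat)
  then obtain p where "Q p"
    and max: "\<And>q. Q q \<Longrightarrow> card (fst q \<inter> snd q) \<le> card (fst p \<inter> snd p)"
    by blast
  then obtain B1 B2 where p: "p = (B1, B2)" and B: "B1 \<in> bases M" "B2 \<in> bases M"
    and r: "card (B1 \<inter> A) = rk M A" "card (B2 \<inter> C) = rk M C"
    by (cases p) (auto simp: Q_def)
  have fin: "finite B1" "finite B2" using B finite_basis by auto
  have grow: "card (B1 \<inter> B2) < card (insert y B1 \<inter> B2)" if "y \<in> B2 - B1" for y
    using that fin by (intro psubset_card_mono) auto
  have 1: "B1 - B2 \<subseteq> C"
  proof (rule ccontr)
    assume "\<not> ?thesis"
    then obtain x where x: "x \<in> B1 - B2" "x \<notin> C" by auto
    then obtain y where y: "y \<in> B2 - B1" "insert y (B1 - {x}) \<in> bases M"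
      using basis_exchange B by blast
    have "card (insert y (B1 - {x}) \<inter> A) = rk M A"
      using card_insert_Diff_Int_ge[of B1 x A y] card_Int_le_rk[OF y(2), of A] x y r fin assms
      by (metis DiffD1 DiffD2 order_antisym subsetD)
    then have "Q (insert y (B1 - {x}), B2)" using B r y by (simp add: Q_def)
    moreover have "insert y (B1 - {x}) \<inter> B2 = insert y B1 \<inter> B2" using x by auto
    ultimately show False using max grow[OF y(1)] p by fastforce
  qed
  have 2: "B2 - B1 \<subseteq> A"
  proof (rule ccontr)
    assume "\<not> ?thesis"
    then obtain x where x: "x \<in> B2 - B1" "x \<notin> A" by auto
    then obtain y where y: "y \<in> B1 - B2" "insert y (B2 - {x}) \<in> bases M"
      using basis_exchange B by blast
    have "card (insert y (B2 - {x}) \<inter> C) = rk M C"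
      using card_insert_Diff_Int_ge[of B2 x C y] card_Int_le_rk[OF y(2), of C] x y r fin 1
      by (metis DiffD1 DiffD2 order_antisym subsetD)
    then have "Q (B1, insert y (B2 - {x}))" using B r y by (simp add: Q_def)
    moreover have "card (B1 \<inter> B2) < card (B1 \<inter> insert y (B2 - {x}))"
      using x y fin by (intro psubset_card_mono) auto
    ultimately show False using max p by fastforce
  qed
  have split: "card (B \<inter> X) = card (B1 \<inter> B2 \<inter> X) + card ((B - D) \<inter> X)"
    if "B = B1 \<and> D = B2 \<or> B = B2 \<and> D = B1" for B D X
  proof -
    have "B \<inter> X = (B1 \<inter> B2 \<inter> X) \<union> ((B - D) \<inter> X)" using that by auto
    moreover have "finite B" using that fin by auto
    ultimately show ?thesis
      using that fin by (simp only:) (rule card_Un_disjoint; auto)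
  qed
  have "card B1 = card B2" by (rule card_bases[OF B])
  with split[of B1 B2 UNIV] split[of B2 B1 UNIV] have eq: "card (B1 - B2) = card (B2 - B1)" by auto
  have "card (B1 \<inter> C) = card (B1 \<inter> B2 \<inter> C) + card (B1 - B2)"
    using split[of B1 B2 C] 1 by (simp add: Int_absorb2)
  moreover have "card (B2 \<inter> C) \<le> card (B1 \<inter> B2 \<inter> C) + card (B2 - B1)"
    using split[of B2 B1 C] fin by (simp add: card_mono)
  ultimately have "card (B1 \<inter> C) = rk M C"
    using eq r card_Int_le_rk[OF B(1), of C] by simp
  then show ?thesis using B(1) r(1) by blast
qed

text \<open>Monotonicity of closure. If \<open>x\<close> raised the rank of \<open>C\<close>, a
  basis attaining the ranks of both \<open>A\<close> and \<open>insert x C\<close> would contain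
  \<open>x\<close>, and \<open>x\<close> would raise the rank of \<open>A\<close> as well.\<close>

lemma rk_insert_eq_mono:
  assumes "rk M (insert x A) = rk M A" "A \<subseteq> C"
  shows "rk M (insert x C) = rk M C"
proof (rule ccontr)
  assume "\<not> ?thesis"
  then have less: "rk M C < rk M (insert x C)"
    using rk_mono[OF subset_insertI, of C x] by linarith
  obtain B where B: "B \<in> bases M" "card (B \<inter> A) = rk M A" "card (B \<inter> insert x C) = rk M (insert x C)"
    using basis_attaining_chain[of A "insert x C"] assms by auto
  have "\<not> card (B \<inter> insert x C) \<le> card (B \<inter> C)"
    using card_Int_le_rk[OF B(1), of C] less B(3) by simp
  then have x: "x \<in> B" "x \<notin> C"
    by (auto simp: Int_insert_right insert_absorb split: if_splits)
  then have "B \<inter> insert x A = insert x (B \<inter> A)" "x \<notin> A"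
    using assms(2) by auto
  then have "card (B \<inter> insert x A) = Suc (card (B \<inter> A))"
    using finite_basis[OF B(1)] by simp
  then show False
    using card_Int_le_rk[OF B(1), of "insert x A"] B assms by simp
qed

section \<open>Rank functions and axioms of minors\<close>

lemma rk_restriction: "X \<subseteq> F \<Longrightarrow> rk (restriction M F) X = rk M X"
proof -
  assume X: "X \<subseteq> F"
  have "bases (restriction M F) = (\<lambda>B. B \<inter> F) ` {B \<in> bases M. card (B \<inter> F) = rk M F}"
    by (auto simp: restriction_def)
  then have "(\<lambda>B. card (B \<inter> X)) ` bases (restriction M F) =
      (\<lambda>B. card (B \<inter> X)) ` {B \<in> bases M. card (B \<inter> F) = rk M F}"
    using X by (simp add: image_image Int_assoc Int_absorb1)
  moreover have "Max ((\<lambda>B. card (B \<inter> X)) ` {B \<in> bases M. card (B \<inter> F) = rk M F}) = rk M X"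
  proof (rule Max_eqI)
    show "rk M X \<in> (\<lambda>B. card (B \<inter> X)) ` {B \<in> bases M. card (B \<inter> F) = rk M F}"
      using basis_attaining_chain[OF X] by force
  qed (use finite_bases card_Int_le_rk in auto)
  ultimately show ?thesis by (simp add: rk_def)
qed

text \<open>A basis attaining the ranks of both \<open>F\<close> and \<open>X \<union> F\<close>
  splits along \<open>F\<close>. The additive form avoids truncated subtraction.\<close>

lemma rk_contraction:
  assumes "X \<inter> F = {}"
  shows "rk (contraction M F) X + rk M F = rk M (X \<union> F)"
proof -
  let ?S = "{B \<in> bases M. card (B \<inter> F) = rk M F}"
  have card: "card (B \<inter> (X \<union> F)) = card ((B - F) \<inter> X) + card (B \<inter> F)" if "B \<in> bases M" for B
  proof -
    have "B \<inter> (X \<union> F) = ((B - F) \<inter> X) \<union> (B \<inter> F)" using assms by auto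
    then show ?thesis
      using finite_basis[OF that] by (simp only:) (rule card_Un_disjoint; auto)
  qed
  have "(\<lambda>B. card (B \<inter> X)) ` bases (contraction M F) = (\<lambda>B. card ((B - F) \<inter> X)) ` ?S"
    by (auto simp: contraction_def image_iff)
  moreover have "Max ((\<lambda>B. card ((B - F) \<inter> X)) ` ?S) = rk M (X \<union> F) - rk M F"
  proof (rule Max_eqI)
    obtain B where "B \<in> ?S" "card (B \<inter> (X \<union> F)) = rk M (X \<union> F)"
      using basis_attaining_chain[of F "X \<union> F"] by auto
    then show "rk M (X \<union> F) - rk M F \<in> (\<lambda>B. card ((B - F) \<inter> X)) ` ?S"
      using card[of B] by force
  next
    fix k assume "k \<in> (\<lambda>B. card ((B - F) \<inter> X)) ` ?S"
    then obtain B where "B \<in> ?S" "k = card ((B - F) \<inter> X)" by auto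
    then show "k \<le> rk M (X \<union> F) - rk M F"
      using card[of B] card_Int_le_rk[of B "X \<union> F"] by simp
  qed (use finite_bases in auto)
  ultimately show ?thesis
    using rk_mono[of F "X \<union> F"] by (simp add: rk_def)
qed

text \<open>Elements of \<open>B\<close> outside \<open>A\<close> and \<open>C\<close> are exchanged
  for elements of \<open>C\<close>. The new element cannot lie in \<open>A\<close>, since that would
  exceed the rank of \<open>A\<close>; so the part inside \<open>A\<close> stays fixed.\<close>

lemma basis_switch_outside:
  assumes "B \<in> bases M" "C \<in> bases M" "card (B \<inter> A) = rk M A" "card (C \<inter> A) = rk M A"
  shows "(B \<inter> A) \<union> (C - A) \<in> bases M"
  using assms(1,3)
proof (induction "card (B - A - C)" arbitrary: B rule: less_induct)
  case less
  have fin: "finite B" "finite C" using less.prems assms(2) finite_basis by auto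
  show ?case
  proof (cases "B - A \<subseteq> C")
    case True
    have "card (B - A) + card (B \<inter> A) = card B" "card (C - A) + card (C \<inter> A) = card C"
      using fin by (metis card_Diff_subset_Int card_mono finite_Int inf_le1 le_add_diff_inverse2)+
    then have "card (C - A) \<le> card (B - A)"
      using less.prems assms card_bases[of B C] by simp
    then have "B - A = C - A"
      using True fin by (intro card_seteq) auto
    then have "(B \<inter> A) \<union> (C - A) = B" by auto
    then show ?thesis using less.prems by simp
  next
    case False
    then obtain x where x: "x \<in> B - C" "x \<notin> A" by auto
    then obtain y where y: "y \<in> C - B" "insert y (B - {x}) \<in> bases M"
      using basis_exchange less.prems assms(2) by blast
    have "y \<notin> A"
    proof
      assume "y \<in> A"
      then have "insert y (B - {x}) \<inter> A = insert y (B \<inter> A)" using x by auto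
      then have "card (insert y (B - {x}) \<inter> A) = Suc (rk M A)" using y fin less.prems by simp
      then show False using card_Int_le_rk[OF y(2), of A] by simp
    qed
    then have eq: "insert y (B - {x}) \<inter> A = B \<inter> A" using x by auto
    have "insert y (B - {x}) - A - C = B - A - C - {x}" using y by auto
    then have "card (insert y (B - {x}) - A - C) < card (B - A - C)"
      using x fin by (simp only:) (rule card_Diff1_less; auto)
    from less.hyps[OF this y(2)] show ?thesis using eq less.prems by simp
  qed
qed

lemma matroid_contraction: "matroid (contraction M F)"
proof
  show "finite (ground (contraction M F))"
    using finite_ground by (simp add: contraction_def)
  show "B \<subseteq> ground (contraction M F)" if "B \<in> bases (contraction M F)" for B
    using that bases_subset by (auto simp: contraction_def)
  show "bases (contraction M F) \<noteq> {}"
    using rk_attained[of F] by (auto simp: contraction_def)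
next
  fix B C x
  assume "B \<in> bases (contraction M F)" "C \<in> bases (contraction M F)" and x: "x \<in> B - C"
  then obtain B' C' where B': "B' \<in> bases M" "card (B' \<inter> F) = rk M F" "B = B' - F"
    and C': "C' \<in> bases M" "card (C' \<inter> F) = rk M F" "C = C' - F"
    by (auto simp: contraction_def)
  \<comment> \<open>Giving both bases the same part inside \<open>F\<close> forces the exchanged
    element to lie outside \<open>F\<close>.\<close>
  let ?C = "(B' \<inter> F) \<union> (C' - F)"
  have "?C \<in> bases M" using basis_switch_outside B' C' by blast
  moreover have "x \<in> B' - ?C" using x B' C' by auto
  ultimately obtain y where y: "y \<in> ?C - B'" "insert y (B' - {x}) \<in> bases M"
    using basis_exchange B' by blast
  have "insert y (B' - {x}) \<inter> F = B' \<inter> F" "insert y (B - {x}) = insert y (B' - {x}) - F"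
    using x y B' by auto
  then have "insert y (B - {x}) \<in> bases (contraction M F)"
    using y(2) B'(2) unfolding contraction_def by (metis (mono_tags, lifting) CollectI select_convs(2))
  moreover have "y \<in> C - B" using y B' C' by auto
  ultimately show "\<exists>y\<in>C - B. insert y (B - {x}) \<in> bases (contraction M F)" by blast
qed

lemma loopless_iff_rk: "loopless M \<longleftrightarrow> (\<forall>x\<in>ground M. rk M {x} > 0)"
proof -
  have "(\<exists>B\<in>bases M. x \<in> B) \<longleftrightarrow> rk M {x} > 0" for x
  proof
    assume "\<exists>B\<in>bases M. x \<in> B"
    then obtain B where "B \<in> bases M" "B \<inter> {x} = {x}" by auto
    then show "rk M {x} > 0" using card_Int_le_rk[of B "{x}"] by simp
  next
    assume "rk M {x} > 0"
    then obtain B where "B \<in> bases M" "card (B \<inter> {x}) > 0"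
      using rk_attained[of "{x}"] by force
    then show "\<exists>B\<in>bases M. x \<in> B" by (auto simp: card_gt_0_iff)
  qed
  then show ?thesis by (simp add: loopless_def)
qed

lemma loopless_contraction:
  assumes "F \<in> flats M"
  shows "loopless (contraction M F)"
proof -
  interpret C: matroid "contraction M F" by (rule matroid_contraction)
  have "rk (contraction M F) {x} > 0" if "x \<in> ground M - F" for x
  proof -
    have "rk M F < rk M (insert x F)" using that assms by (simp add: flats_def)
    then show ?thesis using that rk_contraction[of "{x}" F] by simp
  qed
  then show ?thesis
    by (simp add: C.loopless_iff_rk) (simp add: contraction_def)
qed

section \<open>Flats as the support of the subset recursion\<close>

abbreviation int_rk :: "'a set \<Rightarrow> int" where "int_rk A \<equiv> int (rk M A)"

lemma mono_on_rk: "mono_on (Pow (ground M)) int_rk"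
  by (auto intro!: mono_onI rk_mono)

text \<open>Let \<open>x\<close> outside \<open>A\<close> not raise the rank of \<open>A\<close>.
  Then it raises the rank of no superset, so strict supersets without \<open>x\<close> have value 0
  by induction, and what remains is the Z-sum of \<open>insert x A\<close>. This is palindromic for
  the length at \<open>A\<close>, the ranks being equal, so nothing is left to correct.\<close>

lemma boolean_kl_eq_0_if_not_flat:
  assumes "A \<subseteq> ground M" "A \<notin> flats M"
  shows "boolean_kl int_rk (ground M) A = 0"
proof -
  let ?E = "ground M"
  have "boolean_kl int_rk ?E A = 0" if "x \<in> ?E - A" "rk M (insert x A) = rk M A" "A \<subseteq> ?E" for x A
    using finite_ground that(3,1,2)
  proof (induction A rule: interval_induct)
    case (step A)
    show ?case
    proof (cases "rk M A = rk M ?E")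
      case True
      then show ?thesis using step.prems by (intro boolean_kl_rank_0) auto
    next
      case False
      let ?f = "\<lambda>C. monom 1 (nat (int_rk C - int_rk A)) * boolean_kl int_rk ?E C"
      have "(\<Sum>C | A \<subset> C \<and> C \<subseteq> ?E. ?f C) = (\<Sum>C | insert x A \<subseteq> C \<and> C \<subseteq> ?E. ?f C)"
        using step rk_insert_eq_mono[of x A] finite_ground
        by (intro sum.mono_neutral_right) auto
      also have "\<dots> = boolean_Z int_rk ?E (insert x A)"
        by (simp add: boolean_Z_def step.prems)
      finally have s: "(\<Sum>C | A \<subset> C \<and> C \<subseteq> ?E. ?f C) = boolean_Z int_rk ?E (insert x A)" .
      moreover have "reversal (nat (int_rk ?E - int_rk A)) \<dots> = \<dots>"
        using reversal_boolean_Z[OF finite_ground mono_on_rk, of "insert x A"] step by simp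
      ultimately show ?thesis
        using False by (subst boolean_kl.simps) (use step.prems in \<open>auto simp: Let_def lower_half_def\<close>)
    qed
  qed
  moreover obtain x where "x \<in> ?E - A" "\<not> rk M A < rk M (insert x A)"
    using assms by (auto simp: flats_def)
  ultimately show ?thesis
    using assms(1) rk_mono[of A "insert x A"] by (metis le_neq_implies_less subset_insertI)
qed

lemma boolean_kl_contraction:
  assumes "F \<subseteq> ground M"
  shows "boolean_kl (\<lambda>A. int (rk (contraction M F) A)) (ground M - F) {} = boolean_kl int_rk (ground M) F"
proof -
  have image: "(\<lambda>A. A \<union> F) ` {C. {} \<subseteq> C \<and> C \<subseteq> ground M - F} = {C. F \<subseteq> C \<and> C \<subseteq> ground M}"
  proof (intro equalityI subsetI)
    fix C assume "C \<in> {C. F \<subseteq> C \<and> C \<subseteq> ground M}"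
    then have "C = (C - F) \<union> F" "C - F \<subseteq> ground M - F" by auto
    then show "C \<in> (\<lambda>A. A \<union> F) ` {C. {} \<subseteq> C \<and> C \<subseteq> ground M - F}" by blast
  qed (use assms in auto)
  have rank: "int_rk (D \<union> F) - int_rk (C \<union> F) = int (rk (contraction M F) D) - int (rk (contraction M F) C)"
    if "{} \<subseteq> C" "C \<subseteq> D" "D \<subseteq> ground M - F" for C D
  proof -
    have "D \<inter> F = {}" "C \<inter> F = {}" using that by auto
    then show ?thesis using rk_contraction[of D F] rk_contraction[of C F] by linarith
  qed
  have "boolean_kl int_rk (ground M) ({} \<union> F) =
      boolean_kl (\<lambda>A. int (rk (contraction M F) A)) (ground M - F) {}"
    by (rule boolean_kl_transport[where h = "\<lambda>A. A \<union> F" and ?A0.0 = "{}" and ?A0'.0 = F])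
      (use finite_ground image rank in \<open>auto intro!: inj_onI\<close>)
  then show ?thesis by simp
qed

end

section \<open>Moebius inversion on the subset lattice\<close>

lemma sum_minus_one_power_card_Pow:
  "finite C \<Longrightarrow> (\<Sum>A\<in>Pow C. (- 1) ^ card A :: 'a::comm_ring_1) = (if C = {} then 1 else 0)"
proof (induction C rule: finite_induct)
  case (insert x C)
  have "(\<Sum>A\<in>insert x ` Pow C. (- 1) ^ card A) = (\<Sum>A\<in>Pow C. (- 1) ^ card (insert x A) :: 'a)"
    using insert.hyps by (intro sum.reindex_cong[of "insert x"]) (auto intro!: inj_onI)
  also have "\<dots> = - (\<Sum>A\<in>Pow C. (- 1) ^ card A)"
    unfolding sum_negf[symmetric]
    using insert.hyps by (intro sum.cong refl) (auto simp: finite_subset subset_iff card_insert_if)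
  finally show ?case
    using insert.hyps unfolding Pow_insert
    by (subst sum.union_disjoint) auto
qed simp

text \<open>Moebius inversion of the palindromic equation turns it into the defining recursion.\<close>

lemma reversal_boolean_kl:
  fixes E :: "'a set"
  assumes "finite E" "mono_on (Pow E) r"
  shows "reversal (nat (r E - r {})) (boolean_kl r E {}) =
    (\<Sum>C\<in>Pow E. (\<Sum>A\<in>Pow C. monom ((- 1) ^ card A) (nat (r C - r A))) * boolean_kl r E C)"
proof -
  have mono: "r A \<le> r B" if "A \<subseteq> B" "B \<subseteq> E" for A B
    using mono_onD[OF assms(2), of A B] that by auto
  let ?q = "\<lambda>C. reversal (nat (r E - r C)) (boolean_kl r E C)"
  \<comment> \<open>Reversing term by term removes the powers of \<open>t\<close>: palindromicity
    turns \<open>boolean_Z\<close> into an unweighted upper sum of reversed values.\<close>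
  have Z: "boolean_Z r E A = (\<Sum>C | A \<subseteq> C \<and> C \<subseteq> E. ?q C)" if "A \<subseteq> E" for A
  proof -
    have "reversal (nat (r E - r A)) (monom 1 (nat (r C - r A)) * boolean_kl r E C) = ?q C"
      if "A \<subseteq> C" "C \<subseteq> E" for C
    proof -
      have "nat (r E - r A) = nat (r C - r A) + nat (r E - r C)"
        using mono[of A C] mono[of C E] that by simp
      then show ?thesis
        using reversal_monom_mult[OF degree_boolean_kl_le[of r C E]] mono[of C E] that by simp
    qed
    then have "reversal (nat (r E - r A)) (boolean_Z r E A) = (\<Sum>C | A \<subseteq> C \<and> C \<subseteq> E. ?q C)"
      by (simp add: boolean_Z_def reversal_sum)
    then show ?thesis using reversal_boolean_Z[OF assms that] by simp
  qed
  have swap: "(\<Sum>A\<in>Pow E. \<Sum>C | A \<subseteq> C \<and> C \<subseteq> E. f A C) = (\<Sum>C\<in>Pow E. \<Sum>A\<in>Pow C. f A C)"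
    for f :: "'a set \<Rightarrow> 'a set \<Rightarrow> int poly"
    unfolding sum.Sigma[OF finite_Pow_iff[THEN iffD2, OF assms(1)] ballI[OF finite_interval(1)[OF assms(1)]]]
    using assms(1) finite_subset
    by (subst sum.Sigma) (auto intro!: sum.reindex_bij_witness[where i = "\<lambda>(C, A). (A, C)" and j = "\<lambda>(A, C). (C, A)"])
  \<comment> \<open>The alternating sum over \<open>A\<close> inverts the upper sum and leaves only
    the term at \<open>{}\<close>.\<close>
  have "(\<Sum>A\<in>Pow E. (- 1) ^ card A * boolean_Z r E A) =
      (\<Sum>A\<in>Pow E. \<Sum>C | A \<subseteq> C \<and> C \<subseteq> E. (- 1) ^ card A * ?q C)"
    by (intro sum.cong refl) (simp add: Z sum_distrib_left)
  also have "\<dots> = (\<Sum>C\<in>Pow E. (\<Sum>A\<in>Pow C. (- 1) ^ card A) * ?q C)"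
    unfolding swap by (simp add: sum_distrib_right)
  also have "\<dots> = (\<Sum>C\<in>Pow E. if C = {} then ?q C else 0)"
    using assms(1) by (intro sum.cong refl) (auto simp: sum_minus_one_power_card_Pow finite_subset)
  also have "\<dots> = ?q {}" using assms(1) by simp
  finally have "?q {} = (\<Sum>A\<in>Pow E. (- 1) ^ card A * boolean_Z r E A)" ..
  also have "\<dots> = (\<Sum>A\<in>Pow E. \<Sum>C | A \<subseteq> C \<and> C \<subseteq> E.
      monom ((- 1) ^ card A) (nat (r C - r A)) * boolean_kl r E C)"
  proof (intro sum.cong refl)
    fix A :: "'a set"
    have c: "(- 1) ^ card A = (monom ((- 1) ^ card A) 0 :: int poly)"
      by (cases "even (card A)") (simp add: monom_0 flip: one_pCons, simp add: monom_0, simp add: one_pCons)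
    then show "(- 1) ^ card A * boolean_Z r E A = (\<Sum>C | A \<subseteq> C \<and> C \<subseteq> E.
        monom ((- 1) ^ card A) (nat (r C - r A)) * boolean_kl r E C)"
      unfolding boolean_Z_def sum_distrib_left c by (simp add: mult_monom flip: mult.assoc)
  qed
  finally show ?thesis
    unfolding swap by (simp add: sum_distrib_right)
qed

section \<open>Existence and uniqueness of Kazhdan-Lusztig polynomials\<close>

definition matroid_kl :: "'a matroid \<Rightarrow> int poly" where
  "matroid_kl M =
    (if matroid M \<and> loopless M then boolean_kl (\<lambda>A. int (rk M A)) (ground M) {} else 0)"

context matroid
begin

lemma matroid_kl_contraction:
  "F \<in> flats M \<Longrightarrow> matroid_kl (contraction M F) = boolean_kl int_rk (ground M) F"
  using boolean_kl_contraction[of F] matroid_contraction[of F] loopless_contraction[of F]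
  by (simp add: matroid_kl_def flats_def) (simp add: contraction_def)

lemma characteristic_poly_restriction:
  assumes "F \<subseteq> ground M"
  shows "characteristic_poly (restriction M F) =
    (\<Sum>A\<in>Pow F. monom ((- 1) ^ card A) (nat (int_rk F - int_rk A)))"
proof -
  have "ground (restriction M F) = F"
    using assms by (auto simp: restriction_def)
  then show ?thesis
    by (auto simp: characteristic_poly_def rk_restriction intro!: sum.cong)
      (metis nat_int of_nat_diff rk_mono)
qed

lemma sum_flats:
  assumes "\<And>F. F \<subseteq> ground M \<Longrightarrow> F \<notin> flats M \<Longrightarrow> f F = 0"
  shows "(\<Sum>F\<in>flats M. f F) = (\<Sum>F\<in>Pow (ground M). f F :: 'b::comm_monoid_add)"
  using assms finite_ground by (intro sum.mono_neutral_left) (auto simp: flats_def)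

lemma finite_flats: "finite (flats M)"
  using finite_ground by (auto intro: finite_subset[of _ "Pow (ground M)"] simp: flats_def)

lemma rank_pos:
  assumes "loopless M" "ground M \<noteq> {}"
  shows "rank M > 0"
proof -
  obtain x where x: "x \<in> ground M" using assms(2) by auto
  then have "0 < rk M {x}" using assms(1) loopless_iff_rk by blast
  also have "\<dots> \<le> rank M" using x by (intro rk_mono) auto
  finally show ?thesis .
qed

lemma empty_in_flats: "loopless M \<Longrightarrow> {} \<in> flats M"
  by (auto simp: flats_def loopless_iff_rk)

lemma contraction_empty: "contraction M {} = M"
  by (simp add: contraction_def)

end

lemma kl_assignment_matroid_kl: "kl_assignment (matroid_kl :: 'a matroid \<Rightarrow> int poly)"
  unfolding kl_assignment_def
proof (intro allI impI conjI)
  fix M :: "'a matroid"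
  assume M: "matroid M" "loopless M"
  then interpret matroid M by simp
  have kl: "matroid_kl M = boolean_kl int_rk (ground M) {}"
    using M by (simp add: matroid_kl_def)
  \<comment> \<open>A loopless matroid of rank 0 has empty ground set, where the recursion starts
    with 1.\<close>
  show "matroid_kl M = 1" if "rank M = 0"
    using that M rank_pos by (cases "ground M = {}") (auto simp: kl)
  show "2 * degree (matroid_kl M) < rank M" if "rank M > 0"
    using degree_boolean_kl_less[of int_rk "{}" "ground M"] that by (simp add: kl)
  have "degree (matroid_kl M) \<le> rank M"
    using degree_boolean_kl_le[of int_rk "{}" "ground M"] by (simp add: kl)
  then have "rev_poly (rank M) (matroid_kl M) =
    (\<Sum>F\<in>Pow (ground M). characteristic_poly (restriction M F) * boolean_kl int_rk (ground M) F)"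
    using reversal_boolean_kl[OF finite_ground mono_on_rk]
    by (simp add: rev_poly_eq_reversal kl characteristic_poly_restriction)
  also have "\<dots> = (\<Sum>F\<in>flats M. characteristic_poly (restriction M F) * boolean_kl int_rk (ground M) F)"
    by (rule sum_flats[symmetric]) (simp add: boolean_kl_eq_0_if_not_flat)
  finally show "rev_poly (rank M) (matroid_kl M) =
    (\<Sum>F\<in>flats M. characteristic_poly (restriction M F) * matroid_kl (contraction M F))"
    by (simp add: matroid_kl_contraction)
qed

text \<open>The flat \<open>{}\<close> contributes \<open>P M\<close> itself, as its characteristic
  polynomial is 1; every other contraction has a smaller ground set. Hence induction determines the
  reversal of \<open>P M\<close> minus \<open>P M\<close>.\<close>

lemma kl_assignment_unique:
  fixes M :: "'a matroid"
  assumes "kl_assignment P" "kl_assignment Q" "matroid M" "loopless M"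
  shows "P M = Q M"
  using assms(3,4)
proof (induction "card (ground M)" arbitrary: M rule: less_induct)
  case less
  interpret matroid M by fact
  show ?case
  proof (cases "rank M = 0")
    case True
    then show ?thesis using assms(1,2) less.prems by (auto simp: kl_assignment_def)
  next
    case False
    let ?s = "\<lambda>P. \<Sum>F\<in>flats M - {{}}. characteristic_poly (restriction M F) * P (contraction M F)"
    have eq: "reversal (rank M) (R M) - R M = ?s R" and deg: "2 * degree (R M) < rank M"
      if "kl_assignment R" for R
    proof -
      show *: "2 * degree (R M) < rank M"
        using that less.prems False by (simp add: kl_assignment_def)
      have "rev_poly (rank M) (R M) =
          (\<Sum>F\<in>flats M. characteristic_poly (restriction M F) * R (contraction M F))"
        using that less.prems by (simp add: kl_assignment_def)
      also have "\<dots> = characteristic_poly (restriction M {}) * R (contraction M {}) + ?s R"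
        using empty_in_flats less.prems finite_flats by (intro sum.remove) auto
      finally show "reversal (rank M) (R M) - R M = ?s R"
        using * by (simp add: rev_poly_eq_reversal characteristic_poly_restriction contraction_empty)
    qed
    have "P (contraction M F) = Q (contraction M F)" if "F \<in> flats M - {{}}" for F
    proof (rule less.hyps)
      have "ground M - F \<subset> ground M"
        using that by (auto simp: flats_def)
      then show "card (ground (contraction M F)) < card (ground M)"
        using finite_ground by (simp add: contraction_def psubset_card_mono)
    qed (use that matroid_contraction loopless_contraction in auto)
    then have "?s P = ?s Q" by simp
    then have "reversal (rank M) (P M) - P M = reversal (rank M) (Q M) - Q M"
      using eq assms(1,2) by simp
    then show ?thesis
      using deg assms(1,2) reversal_diff_inject by blast
  qed
qed

text \<open>Existence and uniqueness on loopless matroids, with the value 0 elsewhere, settle the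
  definite description in \<open>kl_poly\<close>.\<close>

lemma kl_poly_eq: "kl_poly = (matroid_kl :: 'a matroid \<Rightarrow> int poly)"
  unfolding kl_poly_def
proof (rule the_equality)
  show "kl_assignment matroid_kl \<and> (\<forall>M. \<not> (matroid M \<and> loopless M) \<longrightarrow> (matroid_kl M :: int poly) = 0)"
    by (simp add: kl_assignment_matroid_kl matroid_kl_def)
next
  fix P :: "'a matroid \<Rightarrow> int poly"
  assume "kl_assignment P \<and> (\<forall>M. \<not> (matroid M \<and> loopless M) \<longrightarrow> P M = 0)"
  then show "P = matroid_kl"
    using kl_assignment_unique[OF _ kl_assignment_matroid_kl, of P]
    by (intro ext) (metis matroid_kl_def)
qed

lemma (in matroid) Z_poly_eq_boolean_Z: "Z_poly M = boolean_Z int_rk (ground M) {}"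
proof -
  have "Z_poly M = (\<Sum>F\<in>flats M. monom 1 (rk M F) * boolean_kl int_rk (ground M) F)"
    by (simp add: Z_poly_def kl_poly_eq matroid_kl_contraction)
  also have "\<dots> = (\<Sum>F\<in>Pow (ground M). monom 1 (rk M F) * boolean_kl int_rk (ground M) F)"
    by (rule sum_flats) (simp add: boolean_kl_eq_0_if_not_flat)
  finally show ?thesis
    by (simp add: boolean_Z_def Pow_def)
qed

section \<open>Nested matroids\<close>

text \<open>A common form for uniform and Catalan matroids, which differ only in the set
  \<open>K\<close> of positions carrying a lower bound; one rank formula then serves both.\<close>

definition nested_matroid :: "nat \<Rightarrow> nat \<Rightarrow> nat set \<Rightarrow> (nat \<Rightarrow> nat) \<Rightarrow> nat matroid" where
  "nested_matroid N R K s =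
    \<lparr>ground = {1..N},
     bases = {T. T \<subseteq> {1..N} \<and> card T = R \<and> (\<forall>k\<in>K. s k \<le> card (T \<inter> {..k}))}\<rparr>"

text \<open>For the leaving \<open>x\<close>, the least element \<open>y\<close> of
  \<open>C - B\<close> enters. A bound can suffer only at \<open>k\<close> with
  \<open>x \<le> k < y\<close>, and there every element of \<open>C\<close> up to \<open>k\<close>
  already lies in \<open>B\<close>, so the bound for \<open>C\<close> carries over.\<close>

lemma matroid_nested_matroid:
  assumes "bases (nested_matroid N R K s) \<noteq> {}"
  shows "matroid (nested_matroid N R K s)"
proof
  show "finite (ground (nested_matroid N R K s))"
    by (simp add: nested_matroid_def)
  show "T \<subseteq> ground (nested_matroid N R K s)" if "T \<in> bases (nested_matroid N R K s)" for T
    using that by (simp add: nested_matroid_def)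
  show "bases (nested_matroid N R K s) \<noteq> {}" by fact
next
  fix B C x
  assume "B \<in> bases (nested_matroid N R K s)" "C \<in> bases (nested_matroid N R K s)" and x: "x \<in> B - C"
  then have B: "B \<subseteq> {1..N}" "card B = R" "\<And>k. k \<in> K \<Longrightarrow> s k \<le> card (B \<inter> {..k})"
    and C: "C \<subseteq> {1..N}" "card C = R" "\<And>k. k \<in> K \<Longrightarrow> s k \<le> card (C \<inter> {..k})"
    by (simp_all add: nested_matroid_def)
  have fin: "finite B" "finite C" using B(1) C(1) finite_subset by blast+
  have "C - B \<noteq> {}"
  proof
    assume "C - B = {}"
    then have "C \<subset> B" using x by auto
    then have "card C < card B" by (rule psubset_card_mono[OF fin(1)])
    then show False using B(2) C(2) by simp
  qed
  define y where "y = Min (C - B)"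
  have y: "y \<in> C - B" unfolding y_def using \<open>C - B \<noteq> {}\<close> fin by (intro Min_in) auto
  have "s k \<le> card (insert y (B - {x}) \<inter> {..k})" if k: "k \<in> K" for k
  proof (cases "x \<le> k \<and> k < y")
    case False
    then show ?thesis
      using card_insert_Diff_Int_ge[OF fin(1), of x "{..k}" y] B(3)[OF k] x y by fastforce
  next
    case True
    have "C \<inter> {..k} \<subseteq> insert y (B - {x}) \<inter> {..k}"
    proof
      fix z assume z: "z \<in> C \<inter> {..k}"
      then have "z \<notin> C - B"
        using True Min_le[OF finite_Diff[OF fin(2)], of z B] by (auto simp flip: y_def)
      then show "z \<in> insert y (B - {x}) \<inter> {..k}" using z x by auto
    qed
    then have "card (C \<inter> {..k}) \<le> card (insert y (B - {x}) \<inter> {..k})"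
      using fin by (intro card_mono) auto
    then show ?thesis using C(3)[OF k] by simp
  qed
  moreover have "card (insert y (B - {x})) = R"
    using x y fin B(2) by (metis DiffD1 DiffD2 card_Suc_Diff1 card_insert_disjoint finite_Diff)
  ultimately have "insert y (B - {x}) \<in> bases (nested_matroid N R K s)"
    using y B(1) C(1) by (auto simp: nested_matroid_def)
  then show "\<exists>y\<in>C - B. insert y (B - {x}) \<in> bases (nested_matroid N R K s)"
    using y by blast
qed

lemma card_split_atMost:
  fixes B :: "nat set"
  assumes "finite B"
  shows "card B = card (B \<inter> {..k}) + card (B \<inter> {k<..})"
proof -
  have "B = (B \<inter> {..k}) \<union> (B \<inter> {k<..})" by auto
  then have "card B = card ((B \<inter> {..k}) \<union> (B \<inter> {k<..}))" by simp
  also have "\<dots> = card (B \<inter> {..k}) + card (B \<inter> {k<..})"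
    using assms by (intro card_Un_disjoint) auto
  finally show ?thesis .
qed

text \<open>If no \<open>k\<close> were tight, an optimal basis \<open>B\<close> could trade its
  largest element outside \<open>A\<close> for the least missing element of \<open>A\<close> and so
  meet \<open>A\<close> in more elements. The two parts together are a minimum formula for the rank,
  written without subtraction.\<close>

lemma rk_nested_matroid:
  assumes ne: "bases (nested_matroid N R K s) \<noteq> {}" and A: "A \<subseteq> {1..N}"
    and K: "0 \<in> K" "N \<in> K" "s 0 = 0" "s N = R"
  shows rk_nested_matroid_le:
      "k \<in> K \<Longrightarrow> rk (nested_matroid N R K s) A + s k \<le> card (A \<inter> {..k}) + R"
    and rk_nested_matroid_attained:
      "\<exists>k\<in>K. rk (nested_matroid N R K s) A + s k = card (A \<inter> {..k}) + R"
proof -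
  let ?M = "nested_matroid N R K s"
  interpret matroid ?M by (rule matroid_nested_matroid[OF ne])
  obtain B where "B \<in> bases ?M" and rk: "card (B \<inter> A) = rk ?M A"
    using rk_attained by blast
  then have B: "B \<subseteq> {1..N}" "card B = R" "\<And>k. k \<in> K \<Longrightarrow> s k \<le> card (B \<inter> {..k})"
    by (simp_all add: nested_matroid_def)
  have fin: "finite B" "finite A" using B(1) A finite_subset by blast+
  show le: "rk ?M A + s k \<le> card (A \<inter> {..k}) + R" if "k \<in> K" for k
  proof -
    have "card (B \<inter> A) = card (B \<inter> A \<inter> {..k}) + card (B \<inter> A \<inter> {k<..})"
      using fin by (intro card_split_atMost) auto
    also have "\<dots> \<le> card (A \<inter> {..k}) + card (B \<inter> {k<..})"
      using fin by (intro add_mono card_mono) auto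
    finally show ?thesis
      using card_split_atMost[OF fin(1), of k] B(2) B(3)[OF that] rk by simp
  qed
  show "\<exists>k\<in>K. rk ?M A + s k = card (A \<inter> {..k}) + R"
  proof (rule ccontr)
    assume "\<not> ?thesis"
    then have less: "rk ?M A + s k < card (A \<inter> {..k}) + R" if "k \<in> K" for k
      using le[OF that] that by (meson le_neq_implies_less)
    \<comment> \<open>Strictness at \<open>k = N\<close> yields an element of \<open>A\<close>
      outside \<open>B\<close>; strictness at \<open>k = 0\<close>, used below, yields an element of
      \<open>B\<close> outside \<open>A\<close>.\<close>
    have "A \<inter> {..N} = A" using A by auto
    then have "\<not> A \<subseteq> B"
      using less[OF K(2)] K rk by (auto simp: Int_absorb1)
    define y where "y = Min (A - B)"
    have y: "y \<in> A - B" unfolding y_def using \<open>\<not> A \<subseteq> B\<close> fin by (intro Min_in) auto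
    have "A \<inter> {..0} = {}" using A by auto
    then have "\<not> B \<subseteq> A"
      using less[OF K(1)] K rk B(2) by (auto simp: Int_absorb2)
    define z where "z = Max (B - A)"
    have z: "z \<in> B - A" unfolding z_def using \<open>\<not> B \<subseteq> A\<close> fin by (intro Max_in) auto
    have "s k \<le> card (insert y (B - {z}) \<inter> {..k})" if k: "k \<in> K" for k
    proof (cases "z \<le> k \<and> k < y")
      case False
      then show ?thesis
        using card_insert_Diff_Int_ge[OF fin(1), of z "{..k}" y] B(3)[OF k] y z by fastforce
    next
      case True
      \<comment> \<open>For \<open>z \<le> k < y\<close>, \<open>A\<close> lies in \<open>B\<close>
        up to \<open>k\<close> and \<open>B\<close> lies in \<open>A\<close> beyond
        \<open>k\<close>; with the strict inequality at \<open>k\<close> this leaves room to remove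
        \<open>z\<close> from the initial segment.\<close>
      have 1: "A \<inter> {..k} \<subseteq> B"
        using True fin by (auto simp: y_def Min_gr_iff dest: Min_le[of "A - B", rotated])
          (metis DiffI Min_le finite_Diff leD le_less_trans)
      have 2: "B \<inter> {k<..} \<subseteq> A"
        using True fin by (auto simp: z_def) (metis DiffI Max_ge finite_Diff leD le_trans)
      have "card (A \<inter> {..k}) + card (B \<inter> {k<..}) = card ((A \<inter> {..k}) \<union> (B \<inter> {k<..}))"
        using fin by (intro card_Un_disjoint[symmetric]) auto
      also have "\<dots> \<le> card (B \<inter> A)"
        using fin 1 2 by (intro card_mono) auto
      finally have "s k < card (B \<inter> {..k})"
        using less[OF k] rk card_split_atMost[OF fin(1), of k] B(2) by simp
      also have "card (B \<inter> {..k}) = Suc (card (B \<inter> {..k} - {z}))"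
        using z True fin by (intro card_Suc_Diff1[symmetric]) auto
      also have "B \<inter> {..k} - {z} = insert y (B - {z}) \<inter> {..k}"
        using True by auto
      finally show ?thesis by simp
    qed
    moreover have "card (insert y (B - {z})) = R"
      using z y fin B(2) by (metis DiffD1 DiffD2 card_Suc_Diff1 card_insert_disjoint finite_Diff)
    ultimately have "insert y (B - {z}) \<in> bases ?M"
      using y z B(1) A by (auto simp: nested_matroid_def)
    then have "card (insert y (B - {z}) \<inter> A) \<le> rk ?M A"
      by (rule card_Int_le_rk)
    moreover have "insert y (B - {z}) \<inter> A = insert y (B \<inter> A)" using y z by auto
    ultimately show False using y fin rk by simp
  qed
qed

section \<open>Entrywise order of sets by counting in initial segments\<close>

lemma nth_sorted_list_of_set_le_iff:
  fixes X :: "nat set"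
  assumes "finite X" "i < card X"
  shows "sorted_list_of_set X ! i \<le> k \<longleftrightarrow> i < card (X \<inter> {..k})"
proof -
  let ?xs = "sorted_list_of_set X"
  let ?J = "{j. j < card X \<and> ?xs ! j \<le> k}"
  have len: "length ?xs = card X" by simp
  have set: "set ?xs = X" using assms(1) by simp
  have "X \<inter> {..k} = (!) ?xs ` ?J"
  proof (intro equalityI subsetI)
    fix x assume x: "x \<in> X \<inter> {..k}"
    then have "x \<in> set ?xs" using set by auto
    then obtain j where "j < length ?xs" "?xs ! j = x" by (auto simp: in_set_conv_nth)
    then show "x \<in> (!) ?xs ` ?J" using x by auto
  next
    fix x assume "x \<in> (!) ?xs ` ?J"
    then show "x \<in> X \<inter> {..k}" using set nth_mem[of _ ?xs] by auto
  qed
  moreover have "inj_on ((!) ?xs) ?J"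
    by (intro inj_onI) (simp add: nth_eq_iff_index_eq)
  ultimately have card: "card (X \<inter> {..k}) = card ?J"
    by (simp add: card_image)
  have mono: "?xs ! j \<le> ?xs ! j'" if "j \<le> j'" "j' < card X" for j j'
    using that by (intro sorted_nth_mono) auto
  show ?thesis
  proof (cases "?xs ! i \<le> k")
    case True
    have "{..i} \<subseteq> ?J"
    proof
      fix j assume "j \<in> {..i}"
      then show "j \<in> ?J" using True assms(2) mono[of j i] by simp
    qed
    then have "card {..i} \<le> card ?J" by (intro card_mono) auto
    then show ?thesis using True card by simp
  next
    case False
    have "?J \<subseteq> {..<i}"
    proof
      fix j assume "j \<in> ?J"
      then show "j \<in> {..<i}" using False mono[of i j] by (cases "i \<le> j") auto
    qed
    then have "card ?J \<le> card {..<i}" by (intro card_mono) auto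
    then show ?thesis using False card by simp
  qed
qed

lemma sorted_list_of_set_le_iff:
  fixes S T :: "nat set"
  assumes "finite S" "finite T" "card T = card S"
  shows "(\<forall>i<card S. sorted_list_of_set T ! i \<le> sorted_list_of_set S ! i) \<longleftrightarrow>
    (\<forall>k. card (S \<inter> {..k}) \<le> card (T \<inter> {..k}))"
proof (intro iffI allI impI)
  fix k assume le: "\<forall>i<card S. sorted_list_of_set T ! i \<le> sorted_list_of_set S ! i"
  show "card (S \<inter> {..k}) \<le> card (T \<inter> {..k})"
  proof (cases "card (S \<inter> {..k})")
    case (Suc c)
    have "card (S \<inter> {..k}) \<le> card S" using assms by (intro card_mono) auto
    then have c: "c < card S" using Suc by simp
    then have "sorted_list_of_set S ! c \<le> k"
      using Suc assms by (simp add: nth_sorted_list_of_set_le_iff)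
    then have "sorted_list_of_set T ! c \<le> k"
      using le c order.trans by blast
    then show ?thesis using Suc c assms by (simp add: nth_sorted_list_of_set_le_iff)
  qed simp
next
  fix i assume le: "\<forall>k. card (S \<inter> {..k}) \<le> card (T \<inter> {..k})" and i: "i < card S"
  \<comment> \<open>The counts are compared at the entry of \<open>S\<close> itself, up to which
    \<open>S\<close> has more than \<open>i\<close> elements, positions starting at 0.\<close>
  have "i < card (S \<inter> {..sorted_list_of_set S ! i})"
    using i assms nth_sorted_list_of_set_le_iff[of S i] by blast
  also have "\<dots> \<le> card (T \<inter> {..sorted_list_of_set S ! i})"
    using le by blast
  finally show "sorted_list_of_set T ! i \<le> sorted_list_of_set S ! i"
    using i assms by (simp add: nth_sorted_list_of_set_le_iff)
qed

section \<open>Catalan and uniform matroids as nested matroids\<close>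

lemma nth_concat_replicate:
  "i < n * length w \<Longrightarrow> concat (replicate n w) ! i = w ! (i mod length w)"
proof (induction n arbitrary: i)
  case (Suc n)
  then show ?case
    by (cases "i < length w") (auto simp: nth_append mod_if[of i])
qed simp

lemma indicated_set_catalan:
  "indicated_set (concat (replicate n (replicate a 0 @ replicate b 1))) =
    {Suc i |i. i < n * (a + b) \<and> a \<le> i mod (a + b)}"
proof -
  let ?w = "replicate a 0 @ replicate b (1::nat)"
  have len: "length (concat (replicate n ?w)) = n * (a + b)"
    by (induction n) auto
  have "concat (replicate n ?w) ! i = 1 \<longleftrightarrow> a \<le> i mod (a + b)" if "i < n * (a + b)" for i
  proof -
    have "a + b > 0" using that by (cases "a + b") auto
    then have "i mod (a + b) < a + b" by simp
    then show ?thesis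
      using nth_concat_replicate[of i n ?w] that by (auto simp: nth_append)
  qed
  then show ?thesis
    unfolding indicated_set_def len by blast
qed

lemma mod_eq_diff_if_in_block:
  "m * q \<le> i \<Longrightarrow> i < m * q + q \<Longrightarrow> i mod q = i - m * q" for i m q :: nat
  by (metis add.commute le_add_diff_inverse less_diff_conv2 mod_less mod_mult_self3)

context
  fixes a b n q :: nat and S :: "nat set"
  assumes q: "q = a + b" "q > 0"
    and S: "S = {Suc i |i. i < n * q \<and> a \<le> i mod q}"
begin

lemma catalan_set_subset: "S \<subseteq> {1..n * q}"
  by (auto simp: S)

lemma catalan_set_block: "m < n \<Longrightarrow> S \<inter> {m * q<..m * q + q} = {m * q + a<..m * q + q}"
proof (intro equalityI subsetI)
  fix e assume "e \<in> S \<inter> {m * q<..m * q + q}"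
  then obtain i where "e = Suc i" "a \<le> i mod q" "m * q \<le> i" "i < m * q + q"
    by (auto simp: S)
  then show "e \<in> {m * q + a<..m * q + q}"
    using mod_eq_diff_if_in_block[of m q i] by auto
next
  fix e assume m: "m < n" and e: "e \<in> {m * q + a<..m * q + q}"
  then obtain i where i: "e = Suc i" "m * q + a \<le> i" "i < m * q + q"
    by (cases e) auto
  have "m * q + q \<le> n * q" using m by (metis Suc_leI add.commute mult_Suc mult_le_mono1)
  then show "e \<in> S \<inter> {m * q<..m * q + q}"
    using i mod_eq_diff_if_in_block[of m q i] by (auto simp: S)
qed

lemma card_catalan_set_block: "m \<le> n \<Longrightarrow> card (S \<inter> {..m * q}) = m * b"
proof (induction m)
  case 0
  have "S \<inter> {..0} = {}" using catalan_set_subset by auto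
  then show ?case by simp
next
  case (Suc m)
  have "S \<inter> {..Suc m * q} = (S \<inter> {..m * q}) \<union> (S \<inter> {m * q<..m * q + q})"
    by auto
  also have "card \<dots> = m * b + b"
    using Suc catalan_set_block[of m] q by (subst card_Un_disjoint) auto
  finally show ?case by simp
qed

text \<open>In the first \<open>a\<close> positions of a block the count of \<open>S\<close> is
  constant, so the bound at the preceding block end suffices. In the last \<open>b\<close> positions
  \<open>S\<close> gains one at every step and \<open>T\<close> at most one, so the bound at the
  following block end suffices.\<close>

lemma schubert_condition_iff:
  assumes "T \<subseteq> {1..n * q}" "card T = n * b"
  shows "(\<forall>k. card (S \<inter> {..k}) \<le> card (T \<inter> {..k})) \<longleftrightarrow>
    (\<forall>m\<le>n. m * b \<le> card (T \<inter> {..m * q}))"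
proof (intro iffI allI impI)
  fix m assume "\<forall>k. card (S \<inter> {..k}) \<le> card (T \<inter> {..k})" "m \<le> n"
  then show "m * b \<le> card (T \<inter> {..m * q})"
    using card_catalan_set_block by metis
next
  fix k assume T: "\<forall>m\<le>n. m * b \<le> card (T \<inter> {..m * q})"
  define m where "m = k div q"
  have k: "m * q \<le> k" "k < m * q + q"
    using q(2) dividend_less_div_times[of q k] by (auto simp: m_def)
  have fin: "finite S" "finite T" using catalan_set_subset assms finite_subset by blast+
  show "card (S \<inter> {..k}) \<le> card (T \<inter> {..k})"
  proof (cases "m < n")
    case False
    then have "n * q \<le> k" using k by (meson le_trans mult_le_mono1 not_less)
    then have "S \<inter> {..k} = S \<inter> {..n * q}" "T \<inter> {..k} = T"
      using catalan_set_subset assms by auto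
    then show ?thesis using card_catalan_set_block[of n] assms by simp
  next
    case m: True
    show ?thesis
    proof (cases "k \<le> m * q + a")
      case True
      have "S \<inter> {..k} \<subseteq> S \<inter> {..m * q}"
      proof
        fix e assume e: "e \<in> S \<inter> {..k}"
        then have "e \<notin> S \<inter> {m * q<..m * q + q}"
          unfolding catalan_set_block[OF m] using True by auto
        then show "e \<in> S \<inter> {..m * q}" using e k by auto
      qed
      then have "card (S \<inter> {..k}) \<le> m * b"
        using card_mono[of "S \<inter> {..m * q}"] fin card_catalan_set_block[of m] m by fastforce
      also have "\<dots> \<le> card (T \<inter> {..m * q})" using T m by simp
      also have "\<dots> \<le> card (T \<inter> {..k})" using fin k by (intro card_mono) auto
      finally show ?thesis .
    next
      case False
      have "{k<..m * q + q} \<subseteq> {m * q + a<..m * q + q}" using False by auto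
      also have "\<dots> \<subseteq> S" using catalan_set_block[OF m] by blast
      finally have "S \<inter> {..Suc m * q} = (S \<inter> {..k}) \<union> {k<..m * q + q}"
        using k by auto
      then have "card (S \<inter> {..Suc m * q}) = card (S \<inter> {..k}) + (m * q + q - k)"
        using fin by (simp only:) (subst card_Un_disjoint; auto)
      moreover have "card (T \<inter> {..Suc m * q}) \<le> card ((T \<inter> {..k}) \<union> {k<..m * q + q})"
        using fin by (intro card_mono) auto
      then have "card (T \<inter> {..Suc m * q}) \<le> card (T \<inter> {..k}) + (m * q + q - k)"
        using fin by (subst (asm) card_Un_disjoint) auto
      moreover have "Suc m * b \<le> card (T \<inter> {..Suc m * q})" "card (S \<inter> {..Suc m * q}) = Suc m * b"
        using T card_catalan_set_block[of "Suc m"] m by (blast intro: Suc_leI)+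
      ultimately show ?thesis by linarith
    qed
  qed
qed

end

text \<open>\<open>J\<close> lists the block ends that carry a bound: all of them for the Catalan
  matroid, only 0 and \<open>n\<close> for the uniform one. The division turns a position back into
  its block number.\<close>

definition block_matroid :: "nat \<Rightarrow> nat \<Rightarrow> nat \<Rightarrow> nat set \<Rightarrow> nat matroid" where
  "block_matroid a b n J =
    nested_matroid (n * (a + b)) (n * b) ((\<lambda>m. m * (a + b)) ` J) (\<lambda>k. k div (a + b) * b)"

lemma catalan_matroid_eq:
  assumes "a + b > 0"
  shows "catalan_matroid a b n = block_matroid a b n {..n}"
proof -
  define q where "q = a + b"
  define S where "S = {Suc i |i. i < n * q \<and> a \<le> i mod q}"
  have q: "q = a + b" "q > 0" using assms by (auto simp: q_def)
  have S: "S \<subseteq> {1..n * q}" by (rule catalan_set_subset[OF q S_def])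
  then have "finite S" "S \<inter> {..n * q} = S" by (auto intro: finite_subset)
  then have card: "card S = n * b" using card_catalan_set_block[OF q S_def, of n] by simp
  have "(\<forall>i<card S. sorted_list_of_set T ! i \<le> sorted_list_of_set S ! i) \<longleftrightarrow>
      (\<forall>k\<in>(\<lambda>m. m * q) ` {..n}. k div q * b \<le> card (T \<inter> {..k}))"
    if "T \<subseteq> {1..n * q}" "card T = n * b" for T
    using that schubert_condition_iff[OF q S_def that] finite_subset[OF that(1)] \<open>finite S\<close> card q(2)
    by (subst sorted_list_of_set_le_iff) auto
  then show ?thesis
    unfolding catalan_matroid_def schubert_matroid_def block_matroid_def nested_matroid_def
      indicated_set_catalan q(1)[symmetric] S_def[symmetric] card
    by (simp add: card cong: conj_cong)
qed

lemma uniform_ab_eq: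
  assumes "a + b > 0"
  shows "uniform_ab a b n = block_matroid a b n {0, n}"
proof -
  have "T \<inter> {..n * (a + b)} = T" if "T \<subseteq> {1..n * (a + b)}" for T
    using that by auto
  then show ?thesis
    using assms unfolding uniform_ab_def uniform_matroid_def block_matroid_def nested_matroid_def
    by auto
qed

section \<open>Rank formula of block matroids\<close>

context
  fixes a b n :: nat and J :: "nat set"
  assumes J: "0 \<in> J" "n \<in> J" "J \<subseteq> {..n}" and pos: "a + b > 0"
begin

lemma bases_block_matroid: "bases (block_matroid a b n J) \<noteq> {}"
proof -
  have "{1..n * b} \<inter> {..m * (a + b)} = {1..min (n * b) (m * (a + b))}" for m by auto
  moreover have "m * b \<le> min (n * b) (m * (a + b))" if "m \<in> J" for m
    using J(3) that by (auto simp: algebra_simps)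
  moreover have "n * b \<le> n * (a + b)" by (simp add: algebra_simps)
  ultimately have "{1..n * b} \<in> bases (block_matroid a b n J)"
    using pos by (auto simp: block_matroid_def nested_matroid_def)
  then show ?thesis by auto
qed

lemma matroid_block_matroid: "matroid (block_matroid a b n J)"
  using bases_block_matroid unfolding block_matroid_def by (rule matroid_nested_matroid)

lemma ground_block_matroid: "ground (block_matroid a b n J) = {1..n * (a + b)}"
  by (simp add: block_matroid_def nested_matroid_def)

lemma rk_block_matroid:
  assumes "A \<subseteq> {1..n * (a + b)}"
  shows rk_block_matroid_le:
      "m \<in> J \<Longrightarrow> rk (block_matroid a b n J) A + m * b \<le> card (A \<inter> {..m * (a + b)}) + n * b"
    and rk_block_matroid_attained:
      "\<exists>m\<in>J. rk (block_matroid a b n J) A + m * b = card (A \<inter> {..m * (a + b)}) + n * b"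
proof -
  let ?K = "(\<lambda>m. m * (a + b)) ` J" and ?s = "\<lambda>k. k div (a + b) * b"
  have K: "0 \<in> ?K" "n * (a + b) \<in> ?K" "?s 0 = 0" "?s (n * (a + b)) = n * b"
    using J(1,2) pos by auto
  note * = rk_nested_matroid[OF bases_block_matroid[unfolded block_matroid_def] assms K]
  show "rk (block_matroid a b n J) A + m * b \<le> card (A \<inter> {..m * (a + b)}) + n * b" if "m \<in> J"
  proof -
    have "m * (a + b) div (a + b) = m" using pos by (intro nonzero_mult_div_cancel_right) simp
    then show ?thesis
      using *(1)[OF imageI, OF that] by (simp only: block_matroid_def)
  qed
  show "\<exists>m\<in>J. rk (block_matroid a b n J) A + m * b = card (A \<inter> {..m * (a + b)}) + n * b"
  proof -
    obtain m where m: "m \<in> J" "rk (block_matroid a b n J) A + m * (a + b) div (a + b) * b =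
        card (A \<inter> {..m * (a + b)}) + n * b"
      using *(2) by (auto simp: block_matroid_def)
    have "m * (a + b) div (a + b) = m" using pos by (intro nonzero_mult_div_cancel_right) simp
    then show ?thesis using m by auto
  qed
qed

end

section \<open>Spitzer's identity for Catalan matroids\<close>

text \<open>Ground elements are encoded as pairs of a block number and a position in the block, so
  the image of \<open>{i}\<close> is the part of \<open>A\<close> in block \<open>i\<close>.\<close>

definition excess :: "nat \<Rightarrow> (nat \<times> nat) set \<Rightarrow> nat \<Rightarrow> int" where
  "excess b A i = int (card (A `` {i})) - int b"

definition total_excess :: "nat \<Rightarrow> (nat \<times> nat) set \<Rightarrow> nat list \<Rightarrow> int" where
  "total_excess b A L = (\<Sum>i\<leftarrow>L. excess b A i)"

text \<open>For \<open>x = 0\<close> this is the least partial sum of the excesses along the list.\<close>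

fun capped :: "nat \<Rightarrow> (nat \<times> nat) set \<Rightarrow> nat list \<Rightarrow> int \<Rightarrow> int" where
  "capped b A [] x = x"
| "capped b A (i # L) x = min 0 (excess b A i + capped b A L x)"

lemma capped_append: "capped b A (L @ L') x = capped b A L (capped b A L' x)"
  by (induction L) auto

lemma total_excess_Nil [simp]: "total_excess b A [] = 0"
  and total_excess_Cons [simp]: "total_excess b A (i # L) = excess b A i + total_excess b A L"
  by (simp_all add: total_excess_def)

lemma excess_mono: "A \<subseteq> B \<Longrightarrow> finite B \<Longrightarrow> excess b A i \<le> excess b B i"
  by (auto simp: excess_def finite_Image intro!: card_mono)

lemma total_excess_mono: "A \<subseteq> B \<Longrightarrow> finite B \<Longrightarrow> total_excess b A L \<le> total_excess b B L"
  by (induction L) (auto intro: add_mono excess_mono)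

lemma capped_mono: "A \<subseteq> B \<Longrightarrow> finite B \<Longrightarrow> x \<le> y \<Longrightarrow> capped b A L x \<le> capped b B L y"
proof (induction L)
  case (Cons i L)
  then show ?case
    using min.mono[OF order.refl add_mono[OF excess_mono[of A B b i]]] by simp
qed simp

text \<open>Together with \<open>capped_attained\<close> this gives the capped sum the shape of the
  rank formula in which all block ends carry bounds.\<close>

lemma capped_le_total_excess: "capped b A L 0 \<le> total_excess b A (take m L)"
  by (induction L arbitrary: m) (auto simp: take_Cons' min.coboundedI2)

lemma capped_attained: "\<exists>m\<le>length L. capped b A L 0 = total_excess b A (take m L)"
proof (induction L)
  case (Cons i L)
  then obtain m where m: "m \<le> length L" "capped b A L 0 = total_excess b A (take m L)" by auto
  show ?case
  proof (cases "excess b A i + capped b A L 0 < 0")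
    case True
    then show ?thesis using m by (intro exI[of _ "Suc m"]) auto
  next
    case False
    then show ?thesis by (intro exI[of _ 0]) auto
  qed
qed simp

lemma excess_full: "i \<in> set L \<Longrightarrow> excess b (set L \<times> {..<a + b}) i = int a"
proof -
  assume "i \<in> set L"
  then have "(set L \<times> {..<a + b}) `` {i} = {..<a + b}" by auto
  then show ?thesis by (simp add: excess_def)
qed

lemma capped_full:
  "set L' \<subseteq> set L \<Longrightarrow> capped b (set L \<times> {..<a + b}) L' 0 = 0"
  by (induction L') (auto simp: excess_full)

lemma total_excess_full:
  "set L' \<subseteq> set L \<Longrightarrow> total_excess b (set L \<times> {..<a + b}) L' = int (length L' * a)"
  by (induction L') (auto simp: excess_full)

section \<open>Relabelling and restricting blocks\<close>

lemma excess_image: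
  assumes "inj_on \<sigma> S" "A \<subseteq> S \<times> UNIV" "i \<in> S"
  shows "excess b (map_prod \<sigma> id ` A) (\<sigma> i) = excess b A i"
proof -
  have "(map_prod \<sigma> id ` A) `` {\<sigma> i} = A `` {i}"
  proof (intro equalityI subsetI)
    fix j assume "j \<in> (map_prod \<sigma> id ` A) `` {\<sigma> i}"
    then obtain i' where "(i', j) \<in> A" "\<sigma> i' = \<sigma> i" by force
    moreover from this have "i' = i"
      using assms by (auto dest: inj_onD)
    ultimately show "j \<in> A `` {i}" by simp
  qed force
  then show ?thesis by (simp add: excess_def)
qed

lemma capped_image:
  assumes "inj_on \<sigma> S" "A \<subseteq> S \<times> UNIV" "set L \<subseteq> S"
  shows "capped b (map_prod \<sigma> id ` A) (map \<sigma> L) x = capped b A L x"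
  using assms(3) by (induction L) (auto simp: excess_image[OF assms(1,2)])

lemma total_excess_image:
  assumes "inj_on \<sigma> S" "A \<subseteq> S \<times> UNIV" "set L \<subseteq> S"
  shows "total_excess b (map_prod \<sigma> id ` A) (map \<sigma> L) = total_excess b A L"
  using assms(3) by (induction L) (auto simp: excess_image[OF assms(1,2)])

lemma excess_Int: "i \<in> S \<Longrightarrow> A \<subseteq> UNIV \<times> Q \<Longrightarrow> excess b (A \<inter> S \<times> Q) i = excess b A i"
  unfolding excess_def by (rule arg_cong[where f = "\<lambda>X. int (card X) - int b"]) auto

lemma capped_Int:
  "set L \<subseteq> S \<Longrightarrow> A \<subseteq> UNIV \<times> Q \<Longrightarrow> capped b (A \<inter> S \<times> Q) L x = capped b A L x"
  by (induction L) (auto simp: excess_Int)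

lemma total_excess_Int:
  "set L \<subseteq> S \<Longrightarrow> A \<subseteq> UNIV \<times> Q \<Longrightarrow> total_excess b (A \<inter> S \<times> Q) L = total_excess b A L"
  by (induction L) (auto simp: excess_Int)

section \<open>Rota-Baxter relation and Spitzer's identity\<close>

context
  fixes a b :: nat
begin

text \<open>On functions of subsets, \<open>min 0\<close> is a Rota--Baxter operator up to relations that \<open>boolean_Z\<close>
  respects; in matroid terms it truncates. The list \<open>js\<close> records the operators applied outside:
  they must be carried along, since \<open>boolean_Z\<close> of an argument does not determine \<open>boolean_Z\<close> of
  its image under \<open>min 0\<close>.\<close>

definition Z_split :: "nat list \<Rightarrow> nat list \<Rightarrow> nat list \<Rightarrow> int poly" where
  "Z_split js ms ks =
    boolean_Z (\<lambda>A. capped b A js (min 0 (total_excess b A ms) + capped b A ks 0))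
      (set (js @ ms @ ks) \<times> {..<a + b}) {}"

definition Z_merge :: "nat list \<Rightarrow> nat list \<Rightarrow> nat list \<Rightarrow> int poly" where
  "Z_merge js ms ks =
    boolean_Z (\<lambda>A. capped b A js (min 0 (total_excess b A ms + capped b A ks 0)))
      (set (js @ ms @ ks) \<times> {..<a + b}) {}"

text \<open>With \<open>x\<close> the total excess of \<open>ms\<close> and \<open>y\<close> the
  excess of \<open>i\<close> plus the capped sum of \<open>ks\<close>, the four terms are
  \<open>min 0 (x + min 0 y)\<close>, \<open>min 0 (min 0 x + y)\<close>,
  \<open>min 0 x + min 0 y\<close> and \<open>min 0 (x + y)\<close>, each followed by the operators
  of \<open>js\<close>. For \<open>x > 0\<close> or \<open>y \<le> 0\<close> they pair up one way,
  for \<open>y > 0\<close> or \<open>x \<le> 0\<close> the other. Positive \<open>a\<close> and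
  nonempty \<open>ms\<close> make \<open>x\<close> and \<open>y\<close> positive on the full
  set.\<close>

lemma Rota_Baxter:
  assumes "a > 0" "ms \<noteq> []"
  shows "Z_merge js ms (i # ks) + Z_split (js @ [i]) ms ks =
    Z_split js ms (i # ks) + Z_merge js (i # ms) ks"
proof -
  let ?L = "js @ ms @ i # ks"
  let ?E = "set ?L \<times> {..<a + b}"
  let ?x = "\<lambda>A. total_excess b A ms" and ?y = "\<lambda>A. excess b A i + capped b A ks 0"
  let ?Z = "\<lambda>f. boolean_Z (\<lambda>A. capped b A js (f (?x A) (?y A))) ?E {}"
  have fin: "finite B" if "B \<subseteq> ?E" for B
    using that by (rule finite_subset) simp
  have "?Z (\<lambda>x y. min 0 (x + min 0 y)) + ?Z (\<lambda>x y. min 0 (min 0 x + y)) =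
    ?Z (\<lambda>x y. min 0 x + min 0 y) + ?Z (\<lambda>x y. min 0 (x + y))"
  proof (rule boolean_Z_four_term[where X = "\<lambda>A. ?x A > 0" and Y = "\<lambda>A. ?y A > 0"])
    fix A B assume AB: "A \<subseteq> B" "B \<subseteq> ?E"
    show "?x B > 0" if "?x A > 0"
      using that total_excess_mono[OF AB(1) fin[OF AB(2)], of b ms] by linarith
    show "?y B > 0" if "?y A > 0"
      using that excess_mono[OF AB(1) fin[OF AB(2)], of b i]
        capped_mono[OF AB(1) fin[OF AB(2)] order.refl, of b ks 0] by linarith
  next
    show "?x ?E > 0"
      using assms by (subst total_excess_full) auto
    show "?y ?E > 0"
      using assms by (subst excess_full, simp, subst capped_full) auto
  qed (auto simp: min_def intro!: arg_cong[of _ _ "capped b _ js"])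
  moreover have "set (js @ ms @ i # ks) = set (js @ (i # ms) @ ks)"
    "set (js @ ms @ i # ks) = set ((js @ [i]) @ ms @ ks)" by auto
  ultimately show ?thesis
    unfolding Z_split_def Z_merge_def
    by (simp only: capped_append capped.simps total_excess_Cons) (simp add: ac_simps)
qed

lemma Z_split_map:
  assumes "inj_on \<sigma> (set (js @ ms @ ks))"
  shows "Z_split (map \<sigma> js) (map \<sigma> ms) (map \<sigma> ks) = Z_split js ms ks"
    and Z_merge_map: "Z_merge (map \<sigma> js) (map \<sigma> ms) (map \<sigma> ks) = Z_merge js ms ks"
proof -
  let ?S = "set (js @ ms @ ks)"
  let ?E = "?S \<times> {..<a + b}"
  have inj: "inj_on (map_prod \<sigma> id) ?E"
    using assms by (intro map_prod_inj_on) auto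
  have E: "map_prod \<sigma> id ` ?E = set (map \<sigma> js @ map \<sigma> ms @ map \<sigma> ks) \<times> {..<a + b}"
    by (simp add: map_prod_surj_on image_Un)
  have A: "A \<subseteq> ?S \<times> UNIV" if "A \<subseteq> ?E" for A using that by auto
  have img: "capped b (map_prod \<sigma> id ` A) (map \<sigma> js) x = capped b A js x"
    "capped b (map_prod \<sigma> id ` A) (map \<sigma> ks) x = capped b A ks x"
    "total_excess b (map_prod \<sigma> id ` A) (map \<sigma> ms) = total_excess b A ms"
    if "A \<subseteq> ?E" for A x
    using A[OF that] by (intro capped_image[OF assms] total_excess_image[OF assms]; auto)+
  show "Z_split (map \<sigma> js) (map \<sigma> ms) (map \<sigma> ks) = Z_split js ms ks"
    unfolding Z_split_def E[symmetric] by (rule boolean_Z_transport[OF _ inj, where k = 0]) (simp, simp only: img add_0_right)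
  show "Z_merge (map \<sigma> js) (map \<sigma> ms) (map \<sigma> ks) = Z_merge js ms ks"
    unfolding Z_merge_def E[symmetric] by (rule boolean_Z_transport[OF _ inj, where k = 0]) (simp, simp only: img add_0_right)
qed

text \<open>By relabelling, only the three lengths matter. For \<open>j = 0\<close> this belongs to
  the direct sum of a uniform matroid on \<open>m\<close> blocks and a Catalan matroid on
  \<open>k\<close> blocks.\<close>

definition split_value :: "nat \<Rightarrow> nat \<Rightarrow> nat \<Rightarrow> int poly" where
  "split_value j m k = Z_split [0..<j] [j..<j + m] [j + m..<j + m + k]"

definition merge_value :: "nat \<Rightarrow> nat \<Rightarrow> nat \<Rightarrow> int poly" where
  "merge_value j m k = Z_merge [0..<j] [j..<j + m] [j + m..<j + m + k]"

lemma Z_split_eq_split_value: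
  assumes "distinct (js @ ms @ ks)"
  shows "Z_split js ms ks = split_value (length js) (length ms) (length ks)"
    and Z_merge_eq_merge_value: "Z_merge js ms ks = merge_value (length js) (length ms) (length ks)"
proof -
  let ?L = "js @ ms @ ks"
  let ?j = "length js" and ?m = "length ms" and ?k = "length ks"
  have inj: "inj_on ((!) ?L) (set ([0..<?j] @ [?j..<?j + ?m] @ [?j + ?m..<?j + ?m + ?k]))"
    using assms by (intro inj_on_nth) auto
  have "map ((!) ?L) [0..<?j] = js" "map ((!) ?L) [?j..<?j + ?m] = ms"
    "map ((!) ?L) [?j + ?m..<?j + ?m + ?k] = ks"
    by (rule nth_equalityI; simp add: nth_append)+
  then show "Z_split js ms ks = split_value ?j ?m ?k" "Z_merge js ms ks = merge_value ?j ?m ?k"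
    using Z_split_map[OF inj] Z_merge_map[OF inj] by (simp_all add: split_value_def merge_value_def)
qed

lemma Rota_Baxter_value:
  assumes "a > 0" "m > 0"
  shows "merge_value j m (Suc k) + split_value (Suc j) m k =
    split_value j m (Suc k) + merge_value j (Suc m) k"
proof -
  let ?js = "[0..<j]" and ?ms = "[j..<j + m]" and ?i = "j + m" and ?ks = "[Suc (j + m)..<Suc (j + m) + k]"
  have dist: "distinct (?js @ ?ms @ ?i # ?ks)" by auto
  have len: "length ?js = j" "length ?ms = m" "length (?i # ?ks) = Suc k" "length ?ks = k"
    "length (?js @ [?i]) = Suc j" "length (?i # ?ms) = Suc m" by simp_all
  have dist': "distinct ((?js @ [?i]) @ ?ms @ ?ks)" "distinct (?js @ (?i # ?ms) @ ?ks)"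
    using dist by auto
  note eqs = Z_merge_eq_merge_value[OF dist, unfolded len] Z_split_eq_split_value[OF dist, unfolded len]
    Z_split_eq_split_value[OF dist'(1), unfolded len] Z_merge_eq_merge_value[OF dist'(2), unfolded len]
  have "?ms \<noteq> []" using assms(2) by simp
  from Rota_Baxter[OF assms(1) this, of ?js ?i ?ks] show ?thesis
    unfolding eqs .
qed

lemma split_value_0: "split_value j m 0 = merge_value j m 0"
  by (simp add: split_value_def merge_value_def Z_split_def Z_merge_def)

text \<open>For a single middle block, merging is just one more operator, so the three lists join
  into one.\<close>

lemma merge_value_1: "merge_value j 1 k = split_value 0 0 (Suc (j + k))"
proof -
  let ?ks = "[Suc j..<Suc j + k]"
  have "[0..<Suc (j + k)] = [0..<j] @ j # ?ks"
    using upt_add_eq_append[of 0 j "Suc k"] upt_conv_Cons[of j "j + Suc k"] by simp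
  moreover have "merge_value j 1 k = Z_merge [0..<j] [j] ?ks"
    by (simp add: merge_value_def)
  ultimately show ?thesis
    by (simp add: split_value_def Z_merge_def Z_split_def capped_append)
qed

text \<open>Induction on \<open>n\<close> for all \<open>j\<close>: \<open>Rota_Baxter_value\<close>
  moves one block to the outer list, replacing \<open>j\<close> by \<open>Suc j\<close>, at the cost
  of a telescoping difference of \<open>merge_value\<close> terms. At the ends of the telescope
  stand the Catalan value on \<open>Suc (j + n)\<close> blocks and a term that cancels the last
  summand.\<close>

lemma Spitzer_aux:
  assumes "a > 0"
  shows "(\<Sum>i<n. split_value j (Suc i) (n - Suc i)) = of_nat n * split_value 0 0 (j + n)"
proof (induction n arbitrary: j)
  case (Suc n)
  let ?e = "\<lambda>i. merge_value j (Suc i) (n - i)"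
  have "split_value j (Suc i) (n - i) = split_value (Suc j) (Suc i) (n - Suc i) + (?e i - ?e (Suc i))"
    if "i < n" for i
    using Rota_Baxter_value[OF assms, of "Suc i" j "n - Suc i"] that
    by (simp add: Suc_diff_Suc algebra_simps)
  then have "(\<Sum>i<n. split_value j (Suc i) (n - i)) =
      (\<Sum>i<n. split_value (Suc j) (Suc i) (n - Suc i)) + (\<Sum>i<n. ?e i - ?e (Suc i))"
    by (simp add: sum.distrib[symmetric])
  also have "\<dots> = of_nat n * split_value 0 0 (Suc j + n) + (?e 0 - ?e n)"
    using sum_lessThan_telescope'[of ?e n] by (simp only: Suc.IH)
  finally show ?case
    using merge_value_1[of j n] split_value_0[of j "Suc n"] by (simp add: algebra_simps)
qed simp

text \<open>The first \<open>m\<close> and the last \<open>k\<close> blocks are disjoint and each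
  summand depends on its own blocks only, so this is a direct sum.\<close>

lemma split_value_mult: "split_value 0 m k = split_value 0 m 0 * split_value 0 0 k"
proof -
  let ?ms = "[0..<m]" and ?ks = "[m..<m + k]" and ?Q = "{..<a + b}"
  let ?E1 = "set ?ms \<times> ?Q" and ?E2 = "set ?ks \<times> ?Q"
  let ?f = "\<lambda>A. min 0 (total_excess b A ?ms)" and ?g = "\<lambda>A. capped b A ?ks 0"
  have E: "set ([] @ ?ms @ ?ks) \<times> ?Q = ?E1 \<union> ?E2" by auto
  have "split_value 0 m k = boolean_Z (\<lambda>A. ?f A + ?g A) (?E1 \<union> ?E2) {}"
    unfolding split_value_def Z_split_def E[symmetric] by simp
  also have "\<dots> = boolean_Z (\<lambda>A. ?f (A \<inter> ?E1) + ?g (A \<inter> ?E2)) (?E1 \<union> ?E2) {}"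
  proof (rule boolean_Z_cong)
    fix A assume "A \<subseteq> ?E1 \<union> ?E2"
    then have "A \<subseteq> UNIV \<times> ?Q" by auto
    then show "?f A + ?g A = ?f (A \<inter> ?E1) + ?g (A \<inter> ?E2)"
      by (simp add: total_excess_Int capped_Int)
  qed simp
  also have "\<dots> = boolean_Z ?f ?E1 {} * boolean_Z ?g ?E2 {}"
  proof (rule boolean_Z_direct_sum)
    show "mono_on (Pow ?E1) ?f"
      by (intro mono_onI min.mono order.refl total_excess_mono) (auto intro: finite_subset)
    show "mono_on (Pow ?E2) ?g"
      by (intro mono_onI capped_mono) (auto intro: finite_subset)
  qed auto
  also have "boolean_Z ?f ?E1 {} = split_value 0 m 0"
    by (simp add: split_value_def Z_split_def)
  also have "boolean_Z ?g ?E2 {} = Z_split [] [] ?ks"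
    by (simp add: Z_split_def)
  also have "\<dots> = split_value 0 0 k"
    using Z_split_eq_split_value[of "[]" "[]" ?ks] by simp
  finally show ?thesis .
qed

lemma split_value_0_0_0: "split_value 0 0 0 = 1"
  by (simp add: split_value_def Z_split_def boolean_Z_def)

lemma Spitzer:
  assumes "a > 0"
  shows "of_nat n * split_value 0 0 n = (\<Sum>i<n. split_value 0 (Suc i) 0 * split_value 0 0 (n - Suc i))"
  unfolding split_value_mult[of _ "_ - _", symmetric] using Spitzer_aux[OF assms, of 0 n] by simp

text \<open>The assumptions \<open>le\<close> and \<open>attained\<close> make \<open>f\<close> the
  minimum of the prefix sums over \<open>J\<close>. By the rank formula the rank is then
  \<open>f\<close> plus the constant \<open>n * b\<close>, which \<open>boolean_Z\<close>
  ignores.\<close>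

lemma Z_poly_block_matroid:
  assumes J: "0 \<in> J" "n \<in> J" "J \<subseteq> {..n}" and "b > 0"
    and le: "\<And>A m. m \<in> J \<Longrightarrow> f A \<le> total_excess b A [0..<m]"
    and attained: "\<And>A. \<exists>m\<in>J. f A = total_excess b A [0..<m]"
  shows "Z_poly (block_matroid a b n J) = boolean_Z f ({..<n} \<times> {..<a + b}) {}"
proof -
  define q where "q = a + b"
  have q: "a + b > 0" "q > 0" using \<open>b > 0\<close> by (auto simp: q_def)
  interpret matroid "block_matroid a b n J" by (rule matroid_block_matroid[OF J q(1)])
  let ?E = "{..<n} \<times> {..<q}"
  \<comment> \<open>Blocks are laid out consecutively, with \<open>Suc\<close> because the ground
    set starts at 1. The first \<open>m\<close> blocks become the positions up to
    \<open>m * q\<close>.\<close>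
  let ?h = "\<lambda>(i, j). Suc (i * q + j)"
  have div: "(i * q + j) div q = i" "(i * q + j) mod q = j" if "j < q" for i j
    using that by auto
  have inj: "inj_on ?h ?E"
    by (rule inj_on_inverseI[where g = "\<lambda>x. ((x - 1) div q, (x - 1) mod q)"]) (auto simp: div)
  have lt: "Suc (i * q + j) \<le> m * q \<longleftrightarrow> i < m" if "j < q" for i j m
    using that div[OF that, of i] less_mult_imp_div_less[of "i * q + j" m q]
    by (metis Suc_le_eq div_less_iff_less_mult q(2))
  have image: "?h ` ?E = {1..n * q}"
  proof (intro equalityI subsetI)
    fix x assume "x \<in> ?h ` ?E"
    then obtain i j where "x = Suc (i * q + j)" "i < n" "j < q" by auto
    then show "x \<in> {1..n * q}" using lt[of j i n] by simp
  next
    fix x assume x: "x \<in> {1..n * q}"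
    then have "x - 1 < n * q" by auto
    then have "(x - 1) div q < n" by (simp add: less_mult_imp_div_less)
    moreover have "x = ?h ((x - 1) div q, (x - 1) mod q)" using x by simp
    ultimately show "x \<in> ?h ` ?E" using q(2) by (intro image_eqI[of _ _ "((x - 1) div q, (x - 1) mod q)"]) auto
  qed
  have card: "int (card (?h ` A \<inter> {..m * q})) - int (m * b) = total_excess b A [0..<m]"
    if A: "A \<subseteq> ?E" for A m
  proof -
    have "?h ` A \<inter> {..m * q} = ?h ` (SIGMA i:{..<m}. A `` {i})"
    proof (intro equalityI subsetI)
      fix x assume "x \<in> ?h ` A \<inter> {..m * q}"
      then obtain i j where x: "x = ?h (i, j)" "(i, j) \<in> A" "Suc (i * q + j) \<le> m * q" by auto
      then have "i < m" using A lt by auto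
      then show "x \<in> ?h ` (SIGMA i:{..<m}. A `` {i})" using x by blast
    next
      fix x assume "x \<in> ?h ` (SIGMA i:{..<m}. A `` {i})"
      then obtain i j where x: "x = ?h (i, j)" "(i, j) \<in> A" "i < m" by auto
      then have "Suc (i * q + j) \<le> m * q" using A lt by auto
      then show "x \<in> ?h ` A \<inter> {..m * q}"
        using x by (intro IntI image_eqI[of _ _ "(i, j)"]) simp_all
    qed
    also have "card \<dots> = card (SIGMA i:{..<m}. A `` {i})"
      using A inj by (intro card_image) (auto intro: inj_on_subset)
    also have "\<dots> = (\<Sum>i<m. card (A `` {i}))"
      using A by (intro card_SigmaI) (auto intro: finite_Image finite_subset)
    finally show ?thesis
      by (simp add: total_excess_def excess_def interv_sum_list_conv_sum_set_nat sum_subtractf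
          lessThan_atLeast0)
  qed
  have "int_rk (?h ` A) = f A + int (n * b)" if A: "A \<subseteq> ?E" for A
  proof -
    have "?h ` A \<subseteq> {1..n * (a + b)}"
      using image_mono[OF A, of ?h] unfolding image by (simp only: q_def)
    note rk = rk_block_matroid_le[OF J q(1) this] rk_block_matroid_attained[OF J q(1) this]
    obtain m where m: "m \<in> J" "f A = total_excess b A [0..<m]" using attained by blast
    then have "int_rk (?h ` A) \<le> f A + int (n * b)"
      using rk(1)[OF m(1)] card[OF A, of m] unfolding q_def by linarith
    moreover obtain m' where m': "m' \<in> J" "rk (block_matroid a b n J) (?h ` A) + m' * b =
        card (?h ` A \<inter> {..m' * (a + b)}) + n * b"
      using rk(2) by blast
    then have "int_rk (?h ` A) \<ge> f A + int (n * b)"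
      using le[OF m'(1), of A] card[OF A, of m'] unfolding q_def by linarith
    ultimately show ?thesis by simp
  qed
  then have "boolean_Z int_rk (?h ` ?E) {} = boolean_Z f ?E {}"
    using inj by (intro boolean_Z_transport) auto
  then show ?thesis
    unfolding image unfolding q_def
    by (simp only: Z_poly_eq_boolean_Z ground_block_matroid[OF J q(1)])
qed

lemma Z_poly_catalan_matroid:
  assumes "b > 0"
  shows "Z_poly (catalan_matroid a b n) = split_value 0 0 n"
proof -
  have "Z_poly (block_matroid a b n {..n}) =
      boolean_Z (\<lambda>A. capped b A [0..<n] 0) ({..<n} \<times> {..<a + b}) {}"
  proof (rule Z_poly_block_matroid)
    fix A m assume "m \<in> {..n}"
    then show "capped b A [0..<n] 0 \<le> total_excess b A [0..<m]"
      using capped_le_total_excess[of b A "[0..<n]" m] by simp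
  next
    fix A
    obtain m where "m \<le> n" "capped b A [0..<n] 0 = total_excess b A (take m [0..<n])"
      using capped_attained[of "[0..<n]" b A] by auto
    then show "\<exists>m\<in>{..n}. capped b A [0..<n] 0 = total_excess b A [0..<m]" by auto
  qed (use assms in auto)
  then show ?thesis
    using assms by (simp add: catalan_matroid_eq split_value_def Z_split_def lessThan_atLeast0)
qed

lemma Z_poly_uniform_ab:
  assumes "b > 0"
  shows "Z_poly (uniform_ab a b m) = split_value 0 m 0"
proof -
  have "Z_poly (block_matroid a b m {0, m}) =
      boolean_Z (\<lambda>A. min 0 (total_excess b A [0..<m])) ({..<m} \<times> {..<a + b}) {}"
    using assms by (intro Z_poly_block_matroid) (auto simp: min_def)
  then show ?thesis
    using assms by (simp add: uniform_ab_eq split_value_def Z_split_def lessThan_atLeast0)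
qed

end

section \<open>Sums over partitions\<close>

lemma of_int_poly_mult:
  "(map_poly of_int (p * q) :: 'a::comm_ring_1 poly) = map_poly of_int p * map_poly of_int q"
  by (simp add: poly_eq_iff coeff_map_poly coeff_mult)

lemma of_int_poly_sum:
  "(map_poly of_int (\<Sum>x\<in>X. f x) :: 'a::comm_ring_1 poly) = (\<Sum>x\<in>X. map_poly of_int (f x))"
  by (simp add: poly_eq_iff coeff_map_poly coeff_sum)

lemma of_int_poly_prod_mset:
  "(map_poly of_int (\<Prod>x\<in>#X. f x) :: 'a::comm_ring_1 poly) = (\<Prod>x\<in>#X. map_poly of_int (f x))"
  by (induction X) (simp_all add: of_int_poly_mult)

lemma of_int_poly_of_nat: "(map_poly of_int (of_nat n) :: 'a::comm_ring_1 poly) = of_nat n"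
  by (simp add: of_nat_poly map_poly_pCons)

lemma sum_mset_eq_sum_count: "sum_mset l = (\<Sum>m\<in>set_mset l. m * count l m)" for l :: "nat multiset"
proof -
  have "sum_mset l = (\<Sum>m\<in>S. m * count l m)" if "finite S" "set_mset l \<subseteq> S" for S
    using that
  proof (induction l)
    case (add x l)
    have "(\<Sum>m\<in>S. m * count (add_mset x l) m) = (\<Sum>m\<in>S. m * count l m + (if m = x then x else 0))"
      by (intro sum.cong) auto
    then show ?case using add by (simp add: sum.distrib)
  qed simp
  then show ?thesis by simp
qed

text \<open>Only the factor of \<open>m\<close> changes: its exponent and the argument of its
  factorial both grow by one.\<close>

lemma z_part_add_mset:
  "z_part (add_mset m l) = z_part l * (m * count (add_mset m l) m)"
proof -
  let ?f = "\<lambda>l i. i ^ count l i * fact (count l i) :: nat"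
  let ?S = "set_mset l - {m}"
  have "z_part (add_mset m l) = ?f (add_mset m l) m * (\<Prod>i\<in>?S. ?f (add_mset m l) i)"
    by (simp add: z_part_def prod.insert_remove)
  also have "(\<Prod>i\<in>?S. ?f (add_mset m l) i) = (\<Prod>i\<in>?S. ?f l i)"
    by (intro prod.cong) auto
  also have "?f (add_mset m l) m = ?f l m * (m * count (add_mset m l) m)"
    by (simp add: algebra_simps)
  also have "?f l m * (m * count (add_mset m l) m) * (\<Prod>i\<in>?S. ?f l i) =
      (?f l m * (\<Prod>i\<in>?S. ?f l i)) * (m * count (add_mset m l) m)"
    by (simp only: ac_simps)
  also have "?f l m * (\<Prod>i\<in>?S. ?f l i) = z_part l"
  proof (cases "m \<in># l")
    case True
    then show ?thesis by (simp add: z_part_def prod.remove[of "set_mset l" m])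
  next
    case False
    then show ?thesis by (simp add: z_part_def not_in_iff)
  qed
  finally show ?thesis .
qed

text \<open>Expand \<open>n\<close> as the sum of \<open>m * count l m\<close> over the distinct
  parts \<open>m\<close>; this factor cancels against the change of \<open>z_part\<close> when one
  copy of \<open>m\<close> is removed. Pairs of a partition and a distinct part of it correspond to
  a part together with a partition of the remainder.\<close>

lemma sum_partitions_rec:
  fixes u :: "nat \<Rightarrow> 'a::field_char_0 poly"
  defines "w \<equiv> \<lambda>l. smult (1 / of_nat (z_part l)) (\<Prod>m\<in>#l. u m)"
  shows "of_nat n * (\<Sum>l\<in>partitions n. w l) =
    (\<Sum>i<n. u (Suc i) * (\<Sum>l\<in>partitions (n - Suc i). w l))"
proof -
  have remove: "of_nat (m * count l m) * w l = u m * w (l - {#m#})" if "m \<in># l" "m > 0" for m l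
  proof -
    obtain k where k: "l = add_mset m k" using multi_member_split[OF \<open>m \<in># l\<close>] by blast
    have "of_nat c * p = smult (of_nat c) p" for c and p :: "'a poly"
      by (simp add: of_nat_poly)
    then have "of_nat (m * count l m) * w l =
        smult (of_nat (m * count l m) * (1 / of_nat (z_part l))) (\<Prod>m\<in>#l. u m)"
      by (simp only: w_def smult_smult)
    also have "of_nat (m * count l m) * (1 / of_nat (z_part l)) = (1 / of_nat (z_part k) :: 'a)"
    proof -
      have "m * count l m \<noteq> 0" using that by auto
      then show ?thesis
        using z_part_add_mset[of m k] unfolding k[symmetric] by (simp add: divide_simps)
    qed
    finally show ?thesis by (simp add: k w_def)
  qed
  have "of_nat n * (\<Sum>l\<in>partitions n. w l) = (\<Sum>l\<in>partitions n. \<Sum>m\<in>set_mset l. u m * w (l - {#m#}))"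
    unfolding sum_distrib_left
  proof (intro sum.cong refl)
    fix l assume l: "l \<in> partitions n"
    then have "n = (\<Sum>m\<in>set_mset l. m * count l m)"
      using sum_mset_eq_sum_count[of l] by (simp add: partitions_def)
    then have "of_nat n * w l = (\<Sum>m\<in>set_mset l. of_nat (m * count l m) * w l)"
      by (metis of_nat_sum sum_distrib_right)
    also have "\<dots> = (\<Sum>m\<in>set_mset l. u m * w (l - {#m#}))"
      using l by (intro sum.cong refl remove) (auto simp: partitions_def intro: gr0I)
    finally show "of_nat n * w l = (\<Sum>m\<in>set_mset l. u m * w (l - {#m#}))" .
  qed
  also have "\<dots> = (\<Sum>(l, m)\<in>(SIGMA l:partitions n. set_mset l). u m * w (l - {#m#}))"
    by (simp add: sum.Sigma finite_partitions)
  also have "\<dots> = (\<Sum>(i, l)\<in>(SIGMA i:{..<n}. partitions (n - Suc i)). u (Suc i) * w l)"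
  \<comment> \<open>The part \<open>m\<close> gets the index \<open>m - 1\<close>; parts are
    positive, so this is invertible.\<close>
  proof (rule sum.reindex_bij_witness[where i = "\<lambda>(i, l). (add_mset (Suc i) l, Suc i)"
        and j = "\<lambda>(l, m). (m - 1, l - {#m#})"], goal_cases)
    case (1 p)
    then obtain l m where p: "p = (l, m)" "m \<in># l" "l \<in> partitions n" by auto
    then have "m > 0" by (auto simp: partitions_def intro: gr0I)
    then show ?case using p by simp
  next
    case (2 p)
    then obtain l m where p: "p = (l, m)" "m \<in># l" "l \<in> partitions n" by auto
    obtain k where k: "l = add_mset m k" using multi_member_split[OF p(2)] by blast
    have "m > 0" using p by (auto simp: partitions_def intro: gr0I)
    then show ?case using p k by (auto simp: partitions_def)
  next
    case (3 p)
    then show ?case by auto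
  next
    case (4 p)
    then show ?case by (auto simp: partitions_def)
  next
    case (5 p)
    then obtain l m where p: "p = (l, m)" "m \<in># l" "l \<in> partitions n" by auto
    then have "m > 0" by (auto simp: partitions_def intro: gr0I)
    then show ?case using p by simp
  qed
  finally show ?thesis
    by (simp add: sum.Sigma[symmetric] finite_partitions sum_distrib_left)
qed

lemma partitions_0: "partitions 0 = {{#}}"
  by (auto simp: partitions_def intro: multiset_nonemptyE)

theorem corollary4p13:
  fixes a b n :: nat
  assumes "a > 0" and "b > 0" and "n > 0"
  shows "(map_poly of_int (Z_poly (catalan_matroid a b n)) :: rat poly) =
    (\<Sum>l\<in>partitions n. smult (1 / of_nat (z_part l)) (map_poly of_int (Z_uniform_part a b l)))"
proof -
  let ?c = "\<lambda>n. map_poly of_int (Z_poly (catalan_matroid a b n)) :: rat poly"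
  let ?u = "\<lambda>m. map_poly of_int (Z_poly (uniform_ab a b m)) :: rat poly"
  let ?h = "\<lambda>n. \<Sum>l\<in>partitions n. smult (1 / of_nat (z_part l)) (\<Prod>m\<in>#l. ?u m)"
  have rec: "of_nat n * ?c n = (\<Sum>i<n. ?u (Suc i) * ?c (n - Suc i))" for n
  proof -
    have "of_nat n * Z_poly (catalan_matroid a b n) =
        (\<Sum>i<n. Z_poly (uniform_ab a b (Suc i)) * Z_poly (catalan_matroid a b (n - Suc i)))"
      using Spitzer[OF assms(1)] assms(2) by (simp add: Z_poly_catalan_matroid Z_poly_uniform_ab)
    from arg_cong[OF this, of "map_poly of_int :: _ \<Rightarrow> rat poly"] show ?thesis
      by (simp add: of_int_poly_mult of_int_poly_sum of_int_poly_of_nat)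
  qed
  \<comment> \<open>Both sides are 1 at \<open>n = 0\<close>, which the recursion reaches, and obey
    the same recursion; the factor \<open>n\<close> cancels over the rationals.\<close>
  have "?c n = ?h n" for n
  proof (induction n rule: less_induct)
    case (less n)
    show ?case
    proof (cases "n = 0")
      case True
      then show ?thesis
        using assms(2) by (simp add: Z_poly_catalan_matroid split_value_0_0_0 partitions_0 z_part_def)
    next
      case False
      have "of_nat n * ?c n = of_nat n * ?h n"
        unfolding rec sum_partitions_rec using less by (intro sum.cong) auto
      then show ?thesis using False by simp
    qed
  qed
  then show ?thesis
    by (simp add: Z_uniform_part_def of_int_poly_prod_mset)
qed

end
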